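(* Let $0<b\le\infty$, $m\in\mathbb N$, and $c_1,\dots,c_m\in\mathbb R$. Assume that $g:HK_{loc}([0,b))^m\to\mathcal A_D([0,b))$ is increasing, and that the Cauchy problem $$y^{(m)}=g(y,y',\dots,y^{(m-1)}),\quad y(0)=c_1,\ y'(0)=c_2,\ \dots,\ y^{(m-1)}(0)=c_m,\qquad(\ast)$$ has a subsolution $\underline y\in S_D$ and a supersolution $\overline y\in S_D$ with $\underline y\le\overline y,\ \underline y'\le\overline y',\dots,\underline y^{(m-1)}\le\overline y^{(m-1)}$ pointwise on $[0,b)$. Then $(\ast)$ has a smallest solution and a greatest solution in the order interval $[\underline y,\overline y]$ of $S_D$, and they are increasing with respect to $g$ and $c_i$, $i=1,\dots,m$. The latter means: if $\hat g$ and $\hat c_1,\dots,\hat c_m$ satisfy the same hypotheses (with the same $\underline y,\overline y$), and $g(x)\preceq\hat g(x)$ for all $x$ and $c_i\le\hat c_i$ for all $i$, then the smallest (respectively greatest) solution in $[\underline y,\overline y]$ for $(g,c_i)$ is $\le$ the one for $(\hat g,\hat c_i)$.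
   Context: Let $I=[0,b)$. $\mathcal D'$ is the space of distributions on $I$: continuous linear functionals on the space $\mathcal D$ of infinitely differentiable functions $\varphi:\mathbb R\to\mathbb R$ whose support is a compact subset of $I$, with $\varphi_n\to\varphi$ in $\mathcal D$ if all supports lie in one compact $K\subseteq I$ and all derivatives converge uniformly on $K$. The derivative is $\langle T',\varphi\rangle=-\langle T,\varphi'\rangle$, and a locally Henstock--Kurzweil ($HK$) integrable function $H$ (i.e. $HK$ integrable on every compact subinterval) is identified with $\varphi\mapsto\int_IH\varphi\,dt$. $\mathcal D^{lc}([0,b))$ is the space of functions $[0,b)\to\mathbb R$ that are locally $HK$ integrable, right continuous at $0$ and left continuous on $(0,b)$. $\mathcal A_D([0,b))$ is the set of distributions $f$ with $f=F'$ for some $F\in\mathcal D^{lc}([0,b))$; $F$ is unique up to a constant and $\int_0^xf:=F(x)-F(0)$. Its order is: $f\preceq g$ iff $\int_0^xf\le\int_0^xg$ for all $x\in[0,b)$. $HK_{loc}([0,b))$ is the space of locally $HK$ integrable functions on $[0,b)$, a.e. equal functions being identified, ordered a.e. pointwise; the product $HK_{loc}([0,b))^m$ is ordered componentwise. Increasing means: $x\le z$ implies $g(x)\preceq g(z)$. $S_D=\{y:[0,b)\to\mathbb R: y^{(m-1)}\in\mathcal D^{lc}([0,b))\}$, where derivatives are distributional and $y=y^{(0)},y',\dots,y^{(m-1)}$ are represented by functions in $\mathcal D^{lc}([0,b))$ (each $y^{(i)}$ being the distributional derivative of $y^{(i-1)}$; pointwise values, such as initial values, refer to these representatives). $S_D$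 is ordered by: $y\le z$ iff $y^{(i)}(t)\le z^{(i)}(t)$ for all $t\in[0,b)$ and $i=0,1,\dots,m-1$; $[\underline y,\overline y]=\{y\in S_D:\underline y\le y\le\overline y\}$. A function $y\in S_D$ is a subsolution of $(\ast)$ if $y^{(m)}\preceq g(y,y',\dots,y^{(m-1)})$ and $y^{(i-1)}(0)\le c_i$ for $i=1,\dots,m$; a supersolution if the reversed inequalities hold; a solution if equalities hold. *)

theory Defs
  imports "HOL-Analysis.Analysis"
begin

text \<open>Functions on \<open>[0,b)\<close> are represented by elements of \<^term>\<open>extensional\<close>, so that
  equality of functions and of functionals is equality in HOL.\<close>

definition Iv :: "ereal \<Rightarrow> real set" where
  "Iv b = {t. 0 \<le> t \<and> ereal t < b}"

definition smooth :: "(real \<Rightarrow> real) \<Rightarrow> bool" where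
  "smooth \<phi> \<longleftrightarrow> (\<forall>k. \<forall>t. (deriv ^^ k) \<phi> field_differentiable at t)"

definition supp :: "(real \<Rightarrow> real) \<Rightarrow> real set" where
  "supp \<phi> = closure {t. \<phi> t \<noteq> 0}"

definition test_functions :: "ereal \<Rightarrow> (real \<Rightarrow> real) set" where
  "test_functions b = {\<phi>. smooth \<phi> \<and> compact (supp \<phi>) \<and> supp \<phi> \<subseteq> Iv b}"

definition test_converges :: "ereal \<Rightarrow> (nat \<Rightarrow> real \<Rightarrow> real) \<Rightarrow> (real \<Rightarrow> real) \<Rightarrow> bool" where
  "test_converges b \<phi>s \<phi> \<longleftrightarrow>
     (\<exists>K. compact K \<and> K \<subseteq> Iv b \<and> supp \<phi> \<subseteq> K \<and> (\<forall>n. supp (\<phi>s n) \<subseteq> K) \<and>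
          (\<forall>k. uniform_limit K (\<lambda>n. (deriv ^^ k) (\<phi>s n)) ((deriv ^^ k) \<phi>) sequentially))"

definition distributions :: "ereal \<Rightarrow> ((real \<Rightarrow> real) \<Rightarrow> real) set" where
  "distributions b = {T \<in> extensional (test_functions b).
     (\<forall>\<phi>\<in>test_functions b. \<forall>\<psi>\<in>test_functions b. T (\<lambda>t. \<phi> t + \<psi> t) = T \<phi> + T \<psi>) \<and>
     (\<forall>r. \<forall>\<phi>\<in>test_functions b. T (\<lambda>t. r * \<phi> t) = r * T \<phi>) \<and>
     (\<forall>\<phi>s. \<forall>\<phi>\<in>test_functions b. (\<forall>n. \<phi>s n \<in> test_functions b) \<longrightarrow> test_converges b \<phi>s \<phi> \<longrightarrow>
        (\<lambda>n. T (\<phi>s n)) \<longlonglongrightarrow> T \<phi>)}"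

definition dist_deriv :: "ereal \<Rightarrow> ((real \<Rightarrow> real) \<Rightarrow> real) \<Rightarrow> ((real \<Rightarrow> real) \<Rightarrow> real)" where
  "dist_deriv b T = (\<lambda>\<phi>\<in>test_functions b. - T (deriv \<phi>))"

definition dist_of :: "ereal \<Rightarrow> (real \<Rightarrow> real) \<Rightarrow> ((real \<Rightarrow> real) \<Rightarrow> real)" where
  "dist_of b H = (\<lambda>\<phi>\<in>test_functions b. integral (Iv b) (\<lambda>t. H t * \<phi> t))"

text \<open>\<open>integrable_on\<close> is Henstock--Kurzweil integrability.\<close>

definition HK_functions :: "ereal \<Rightarrow> (real \<Rightarrow> real) set" where
  "HK_functions b = {H \<in> extensional (Iv b). \<forall>a d. {a..d} \<subseteq> Iv b \<longrightarrow> H integrable_on {a..d}}"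

definition HK_rel :: "ereal \<Rightarrow> ((real \<Rightarrow> real) \<times> (real \<Rightarrow> real)) set" where
  "HK_rel b = {(H, K). H \<in> HK_functions b \<and> K \<in> HK_functions b \<and>
     (AE t in lebesgue. t \<in> Iv b \<longrightarrow> H t = K t)}"

definition HK_loc :: "ereal \<Rightarrow> (real \<Rightarrow> real) set set" where
  "HK_loc b = HK_functions b // HK_rel b"

definition HK_class :: "ereal \<Rightarrow> (real \<Rightarrow> real) \<Rightarrow> (real \<Rightarrow> real) set" where
  "HK_class b H = HK_rel b `` {H}"

text \<open>For elements of \<^term>\<open>HK_loc b\<close> the choice of representatives does not matter.\<close>

definition HK_le :: "ereal \<Rightarrow> (real \<Rightarrow> real) set \<Rightarrow> (real \<Rightarrow> real) set \<Rightarrow> bool" where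
  "HK_le b X Z \<longleftrightarrow> (\<exists>H\<in>X. \<exists>K\<in>Z. AE t in lebesgue. t \<in> Iv b \<longrightarrow> H t \<le> K t)"

definition HK_loc_prod :: "ereal \<Rightarrow> nat \<Rightarrow> (nat \<Rightarrow> (real \<Rightarrow> real) set) set" where
  "HK_loc_prod b m = ({..<m} \<rightarrow>\<^sub>E HK_loc b)"

definition HK_prod_le ::
  "ereal \<Rightarrow> nat \<Rightarrow> (nat \<Rightarrow> (real \<Rightarrow> real) set) \<Rightarrow> (nat \<Rightarrow> (real \<Rightarrow> real) set) \<Rightarrow> bool" where
  "HK_prod_le b m x z \<longleftrightarrow> (\<forall>i<m. HK_le b (x i) (z i))"

definition D_lc :: "ereal \<Rightarrow> (real \<Rightarrow> real) set" where
  "D_lc b = {F \<in> HK_functions b. continuous (at_right 0) F \<and>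
     (\<forall>t\<in>Iv b. 0 < t \<longrightarrow> continuous (at_left t) F)}"

definition A_D :: "ereal \<Rightarrow> ((real \<Rightarrow> real) \<Rightarrow> real) set" where
  "A_D b = {f \<in> distributions b. \<exists>F\<in>D_lc b. f = dist_deriv b (dist_of b F)}"

text \<open>The integral \<open>\<integral>\<^sub>0\<^sup>x f\<close> of \<open>f \<in> A_D b\<close>; the primitive \<open>F\<close> is unique up to a constant.\<close>

definition A_integral :: "ereal \<Rightarrow> ((real \<Rightarrow> real) \<Rightarrow> real) \<Rightarrow> real \<Rightarrow> real" where
  "A_integral b f x =
     (let F = (SOME F. F \<in> D_lc b \<and> f = dist_deriv b (dist_of b F)) in F x - F 0)"

definition A_le :: "ereal \<Rightarrow> ((real \<Rightarrow> real) \<Rightarrow> real) \<Rightarrow> ((real \<Rightarrow> real) \<Rightarrow> real) \<Rightarrow> bool" where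
  "A_le b f h \<longleftrightarrow> (\<forall>x\<in>Iv b. A_integral b f x \<le> A_integral b h x)"

definition dist_deriv_n :: "ereal \<Rightarrow> nat \<Rightarrow> (real \<Rightarrow> real) \<Rightarrow> ((real \<Rightarrow> real) \<Rightarrow> real)" where
  "dist_deriv_n b i y = (dist_deriv b ^^ i) (dist_of b y)"

definition S_D :: "ereal \<Rightarrow> nat \<Rightarrow> (real \<Rightarrow> real) set" where
  "S_D b m = {y \<in> D_lc b. \<forall>i<m. \<exists>u\<in>D_lc b. dist_of b u = dist_deriv_n b i y}"

text \<open>The representative of \<open>y\<^sup>(\<^sup>i\<^sup>)\<close> in \<^term>\<open>D_lc b\<close>, for \<open>y \<in> S_D b m\<close> and \<open>i < m\<close>. It is unique
  because of one-sided continuity at every point of \<open>[0,b)\<close>.\<close>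

definition lc_deriv :: "ereal \<Rightarrow> nat \<Rightarrow> (real \<Rightarrow> real) \<Rightarrow> (real \<Rightarrow> real)" where
  "lc_deriv b i y = (THE u. u \<in> D_lc b \<and> dist_of b u = dist_deriv_n b i y)"

definition S_le :: "ereal \<Rightarrow> nat \<Rightarrow> (real \<Rightarrow> real) \<Rightarrow> (real \<Rightarrow> real) \<Rightarrow> bool" where
  "S_le b m y z \<longleftrightarrow> (\<forall>i<m. \<forall>t\<in>Iv b. lc_deriv b i y t \<le> lc_deriv b i z t)"

definition S_interval :: "ereal \<Rightarrow> nat \<Rightarrow> (real \<Rightarrow> real) \<Rightarrow> (real \<Rightarrow> real) \<Rightarrow> (real \<Rightarrow> real) set" where
  "S_interval b m lo hi = {y \<in> S_D b m. S_le b m lo y \<and> S_le b m y hi}"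

definition jet :: "ereal \<Rightarrow> nat \<Rightarrow> (real \<Rightarrow> real) \<Rightarrow> (nat \<Rightarrow> (real \<Rightarrow> real) set)" where
  "jet b m y = (\<lambda>i\<in>{..<m}. HK_class b (lc_deriv b i y))"

type_synonym rhs = "(nat \<Rightarrow> (real \<Rightarrow> real) set) \<Rightarrow> ((real \<Rightarrow> real) \<Rightarrow> real)"

definition subsolution ::
  "ereal \<Rightarrow> nat \<Rightarrow> rhs \<Rightarrow> (nat \<Rightarrow> real) \<Rightarrow> (real \<Rightarrow> real) \<Rightarrow> bool" where
  "subsolution b m g c y \<longleftrightarrow> y \<in> S_D b m \<and> A_le b (dist_deriv_n b m y) (g (jet b m y)) \<and>
     (\<forall>i\<in>{1..m}. lc_deriv b (i - 1) y 0 \<le> c i)"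

definition supersolution ::
  "ereal \<Rightarrow> nat \<Rightarrow> rhs \<Rightarrow> (nat \<Rightarrow> real) \<Rightarrow> (real \<Rightarrow> real) \<Rightarrow> bool" where
  "supersolution b m g c y \<longleftrightarrow> y \<in> S_D b m \<and> A_le b (g (jet b m y)) (dist_deriv_n b m y) \<and>
     (\<forall>i\<in>{1..m}. c i \<le> lc_deriv b (i - 1) y 0)"

definition solution ::
  "ereal \<Rightarrow> nat \<Rightarrow> rhs \<Rightarrow> (nat \<Rightarrow> real) \<Rightarrow> (real \<Rightarrow> real) \<Rightarrow> bool" where
  "solution b m g c y \<longleftrightarrow> y \<in> S_D b m \<and> dist_deriv_n b m y = g (jet b m y) \<and>
     (\<forall>i\<in>{1..m}. lc_deriv b (i - 1) y 0 = c i)"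

definition increasing_rhs :: "ereal \<Rightarrow> nat \<Rightarrow> rhs \<Rightarrow> bool" where
  "increasing_rhs b m g \<longleftrightarrow> g \<in> HK_loc_prod b m \<rightarrow> A_D b \<and>
     monotone_on (HK_loc_prod b m) (HK_prod_le b m) (A_le b) g"

definition smallest_solution ::
  "ereal \<Rightarrow> nat \<Rightarrow> rhs \<Rightarrow> (nat \<Rightarrow> real) \<Rightarrow> (real \<Rightarrow> real) \<Rightarrow> (real \<Rightarrow> real) \<Rightarrow> (real \<Rightarrow> real) \<Rightarrow> bool"
  where
  "smallest_solution b m g c lo hi y \<longleftrightarrow> y \<in> S_interval b m lo hi \<and> solution b m g c y \<and>
     (\<forall>z\<in>S_interval b m lo hi. solution b m g c z \<longrightarrow> S_le b m y z)"

definition greatest_solution ::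
  "ereal \<Rightarrow> nat \<Rightarrow> rhs \<Rightarrow> (nat \<Rightarrow> real) \<Rightarrow> (real \<Rightarrow> real) \<Rightarrow> (real \<Rightarrow> real) \<Rightarrow> (real \<Rightarrow> real) \<Rightarrow> bool"
  where
  "greatest_solution b m g c lo hi y \<longleftrightarrow> y \<in> S_interval b m lo hi \<and> solution b m g c y \<and>
     (\<forall>z\<in>S_interval b m lo hi. solution b m g c z \<longrightarrow> S_le b m z y)"

end

theory Submission
  imports Defs
begin

text \<open>
  A solution is a fixed point of an increasing operator on an order interval of tuples of
  Henstock--Kurzweil integrable functions, and that order interval is complete up to null sets,
  so the argument of Knaster and Tarski applies.

  The operator. A distribution \<open>h = F'\<close> with \<open>F \<in> D_lc b\<close>, together with initial values
  \<open>c\<close>, determines a tuple \<open>u\<close> by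
  \<open>u (m - 1) t = c m + \<integral>\<^sub>0\<^sup>t h\<close> and \<open>u i t = c (i + 1) + \<integral>\<^sub>0\<^sup>t u (i + 1)\<close>; this is
  \<open>cauchy_jet\<close> below. Lemmas \<open>cauchy_jet_solves\<close> and \<open>lc_deriv_eq_cauchy_jet\<close> say that
  these tuples are exactly the tuples of derivatives of elements of \<^term>\<open>S_D\<close>. They are monotone
  in \<open>h\<close> and \<open>c\<close> (\<open>cauchy_jet_mono\<close>). For \<open>T x = cauchy_jet b m c (g x)\<close> the solutions are
  therefore the fixed points of \<open>T\<close>, and the jets of sub- and supersolutions satisfy \<open>x \<le> T x\<close>
  and \<open>T x \<le> x\<close>. As \<open>T\<close> is increasing, it maps the interval between the jets of \<open>ylo\<close> and \<open>yhi\<close> into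
  itself.

  Completeness. An infimum of functions in \<^term>\<open>D_lc\<close> need not be left continuous, but \<open>g\<close> is
  defined on all classes of locally integrable functions, so the fixed point may be sought there.
  A family of measurable functions has an essential infimum, attained along a countable
  subfamily (\<open>ex_countable_essential_infimum\<close>), and a measurable function between two Henstock--Kurzweil integrable functions is again integrable,
  since its distance to the lower one is dominated by a nonnegative integrable function. A fixed
  point of \<open>T\<close> modulo null sets yields a genuine solution, because the values of \<open>T\<close> lie in
  \<^term>\<open>D_lc\<close> and there an inequality almost everywhere holds everywhere, by one-sided
  continuity (\<open>D_lc_AE_le_imp_le\<close>). The least fixed point is even the least \<open>x\<close> with
  \<open>T x \<le> x\<close>, so the smallest solution lies below every supersolution in the interval. This gives
  the monotone dependence on \<open>g\<close> and \<open>c\<close>, since a solution for larger data is a supersolution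
  for smaller data; greatest solutions are treated dually.

  Distributions. Two facts are needed. First, the indefinite integral of a Henstock--Kurzweil
  integrable function is a distributional primitive of it (\<open>dist_deriv_primitive\<close>); as an
  indefinite integral need not be differentiable everywhere, the integration by parts behind it
  is derived from the second mean value theorem (\<open>HK_by_parts\<close>). Second, a function in
  \<^term>\<open>D_lc\<close> is determined by its distribution, and up to a constant by its distributional
  derivative (\<open>dist_of_inj\<close>, \<open>dist_deriv_eq_imp_diff_const\<close>): integrals against unit bumps on
  \<open>[s,t]\<close> tend to the value at \<open>t > 0\<close> as \<open>s\<close> increases to \<open>t\<close>, and the difference of two unit
  bumps is the derivative of a test function.
\<close>

section \<open>Smooth bump functions\<close>

text \<open>Recursion on the derivative, rather than on the iterates \<open>deriv ^^ k\<close> of a fixed function, lets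
  the sum, product and chain rules be used in inductions on the order.\<close>

primrec differentiable_times :: "nat \<Rightarrow> (real \<Rightarrow> real) \<Rightarrow> bool" where
  "differentiable_times 0 f \<longleftrightarrow> True"
| "differentiable_times (Suc n) f \<longleftrightarrow>
     (\<forall>t. f field_differentiable at t) \<and> differentiable_times n (deriv f)"

lemma smooth_iff_differentiable_times: "smooth f \<longleftrightarrow> (\<forall>n. differentiable_times n f)"
proof -
  have *: "differentiable_times n f \<longleftrightarrow> (\<forall>k<n. \<forall>t. (deriv ^^ k) f field_differentiable at t)" for n f
  proof (induction n arbitrary: f)
    case (Suc n)
    have "(\<forall>k<Suc n. P k) \<longleftrightarrow> P 0 \<and> (\<forall>k<n. P (Suc k))" for P
      using less_Suc_eq_0_disj by auto
    then show ?case
      by (simp add: Suc.IH funpow_Suc_right del: funpow.simps)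
  qed simp
  show ?thesis
    unfolding smooth_def * by blast
qed

lemma deriv_add_fun:
  fixes f g :: "real \<Rightarrow> real"
  assumes "\<forall>t. f field_differentiable at t" "\<forall>t. g field_differentiable at t"
  shows "deriv (\<lambda>t. f t + g t) = (\<lambda>t. deriv f t + deriv g t)"
  using assms by auto

lemma differentiable_times_add:
  "differentiable_times n f \<Longrightarrow> differentiable_times n g \<Longrightarrow> differentiable_times n (\<lambda>t. f t + g t)"
  by (induction n arbitrary: f g) (auto simp: deriv_add_fun intro: field_differentiable_add)

lemma differentiable_times_cmult:
  "differentiable_times n f \<Longrightarrow> differentiable_times n (\<lambda>t. c * f t)"
proof (induction n arbitrary: f)
  case (Suc n)
  then have "deriv (\<lambda>t. c * f t) = (\<lambda>t. c * deriv f t)"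
    by (auto simp: deriv_cmult)
  with Suc show ?case
    by (auto intro!: field_differentiable_mult field_differentiable_const)
qed simp

lemma differentiable_times_Suc_imp:
  "differentiable_times (Suc n) f \<Longrightarrow> differentiable_times n f"
  by (induction n arbitrary: f) auto

lemma differentiable_times_mult:
  "differentiable_times n f \<Longrightarrow> differentiable_times n g \<Longrightarrow> differentiable_times n (\<lambda>t. f t * g t)"
proof (induction n arbitrary: f g)
  case (Suc n)
  then have "deriv (\<lambda>t. f t * g t) = (\<lambda>t. f t * deriv g t + deriv f t * g t)"
    by auto
  with Suc show ?case
    using differentiable_times_Suc_imp[of n f] differentiable_times_Suc_imp[of n g]
    by (auto intro!: field_differentiable_mult differentiable_times_add)
qed simp

lemma differentiable_times_affine:
  "differentiable_times n f \<Longrightarrow> differentiable_times n (\<lambda>t. f (a * t + c))"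
proof (induction n arbitrary: f)
  case (Suc n)
  have D: "((\<lambda>t. f (a * t + c)) has_field_derivative a * deriv f (a * t + c)) (at t)" for t
  proof -
    have "(f has_field_derivative deriv f (a * t + c)) (at (a * t + c))"
      using Suc.prems by (simp add: DERIV_deriv_iff_field_differentiable)
    then have "((\<lambda>t. f (a * t + c)) has_field_derivative deriv f (a * t + c) * a) (at t)"
      by (rule DERIV_chain2) (auto intro!: derivative_eq_intros)
    then show ?thesis by (simp add: mult.commute)
  qed
  then have "deriv (\<lambda>t. f (a * t + c)) = (\<lambda>t. a * deriv f (a * t + c))"
    by (auto simp: DERIV_imp_deriv)
  with Suc D show ?case
    by (auto simp: field_differentiable_def intro!: differentiable_times_cmult)
qed simp

text \<open>The functions \<open>exp (- 1 / x) / x ^ n\<close> on the positive half-line, continued by \<open>0\<close>. Their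
  linear span is closed under differentiation, so all of them are smooth.\<close>

definition flat :: "nat \<Rightarrow> real \<Rightarrow> real" where
  "flat n x = (if 0 < x then exp (- inverse x) * inverse x ^ n else 0)"

text \<open>With \<open>y = 1 / x\<close> this is the decay of \<open>y ^ n / exp y\<close> at infinity.\<close>

lemma flat_tendsto_0: "(flat n \<longlongrightarrow> 0) (at 0)"
proof -
  have "((\<lambda>x. inverse x ^ n / exp (inverse x)) \<longlongrightarrow> 0) (at_right (0::real))"
    using tendsto_power_div_exp_0 filterlim_inverse_at_top_right by (rule filterlim_compose)
  then have "(flat n \<longlongrightarrow> 0) (at_right 0)"
    by (rule Lim_transform_eventually)
       (auto simp: flat_def exp_minus field_simps eventually_at_filter)
  moreover have "(flat n \<longlongrightarrow> 0) (at_left 0)"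
    by (rule tendsto_eventually) (auto simp: flat_def eventually_at_filter)
  ultimately show ?thesis
    by (simp add: filterlim_at_split)
qed

lemma flat_has_derivative:
  "(flat n has_field_derivative flat (n + 2) x - of_nat n * flat (n + 1) x) (at x)"
proof -
  consider "x < 0" | "x = 0" | "0 < x" by linarith
  then show ?thesis
  proof cases
    case 1
    have "((\<lambda>x. 0) has_field_derivative flat (n + 2) x - of_nat n * flat (n + 1) x) (at x)"
      using 1 by (auto simp: flat_def)
    then show ?thesis
      by (rule has_field_derivative_transform_within_open[where S = "{..<0}"])
         (use 1 in \<open>auto simp: flat_def\<close>)
  next
    case 2
    \<comment> \<open>The difference quotient of \<open>flat n\<close> at \<open>0\<close> is \<open>flat (n + 1)\<close>.\<close>
    have "((\<lambda>y. (flat n y - flat n 0) / (y - 0)) \<longlongrightarrow> 0) (at 0)"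
      using flat_tendsto_0[of "n + 1"]
      by (rule Lim_transform_eventually) (auto simp: flat_def field_simps eventually_at_filter)
    then show ?thesis
      using 2 by (simp add: has_field_derivative_iff flat_def)
  next
    case 3
    have "((\<lambda>x. exp (- inverse x) * inverse x ^ n) has_field_derivative
            exp (- inverse x) * inverse x ^ 2 * inverse x ^ n +
            exp (- inverse x) * (of_nat n * inverse x ^ (n - 1) * (- (inverse x ^ 2)))) (at x)"
      using 3 by (auto intro!: derivative_eq_intros simp: power2_eq_square)
    also have "exp (- inverse x) * inverse x ^ 2 * inverse x ^ n +
            exp (- inverse x) * (of_nat n * inverse x ^ (n - 1) * (- (inverse x ^ 2))) =
            flat (n + 2) x - of_nat n * flat (n + 1) x"
      using 3 by (cases n) (simp_all add: flat_def power2_eq_square)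
    finally have "((\<lambda>x. exp (- inverse x) * inverse x ^ n) has_field_derivative
            flat (n + 2) x - of_nat n * flat (n + 1) x) (at x)" .
    then show ?thesis
      by (rule has_field_derivative_transform_within_open[where S = "{0<..}"])
         (use 3 in \<open>auto simp: flat_def\<close>)
  qed
qed

lemma differentiable_times_flat: "differentiable_times k (flat n)"
proof (induction k arbitrary: n)
  case (Suc k)
  have "deriv (flat n) = (\<lambda>x. flat (n + 2) x + (- of_nat n) * flat (n + 1) x)"
    using flat_has_derivative[of n] by (auto simp: DERIV_imp_deriv)
  then show ?case
    using flat_has_derivative[of n] differentiable_times_add[OF Suc differentiable_times_cmult[OF Suc]]
    by (simp only: differentiable_times.simps field_differentiable_def) blast
qed simp

definition bump0 :: "real \<Rightarrow> real \<Rightarrow> real \<Rightarrow> real" where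
  "bump0 s t x = flat 0 (x - s) * flat 0 (t - x)"

definition bump :: "real \<Rightarrow> real \<Rightarrow> real \<Rightarrow> real" where
  "bump s t x = inverse (integral {s..t} (bump0 s t)) * bump0 s t x"

lemma smooth_imp_differentiable: "smooth f \<Longrightarrow> f field_differentiable at t"
  by (metis funpow_0 smooth_def)

lemma smooth_imp_continuous_on: "smooth f \<Longrightarrow> continuous_on A f"
  using field_differentiable_imp_continuous_at smooth_imp_differentiable
  by (blast intro: continuous_at_imp_continuous_on)

lemma smooth_has_derivative: "smooth f \<Longrightarrow> (f has_field_derivative deriv f x) (at x within A)"
  using smooth_imp_differentiable DERIV_deriv_iff_field_differentiable
    has_field_derivative_at_within by blast

lemma smooth_deriv: "smooth f \<Longrightarrow> smooth (deriv f)"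
  by (meson smooth_iff_differentiable_times differentiable_times.simps(2))

lemma smooth_antiderivative:
  assumes "\<And>t. (f has_field_derivative f' t) (at t)" "smooth f'"
  shows "smooth f"
proof -
  have "deriv f = f'"
    using assms(1) by (auto simp: DERIV_imp_deriv)
  moreover have "f field_differentiable at t" for t
    using assms(1) field_differentiable_def by blast
  ultimately have "differentiable_times (Suc n) f" for n
    using assms(2) by (simp add: smooth_iff_differentiable_times)
  then show ?thesis
    unfolding smooth_iff_differentiable_times using differentiable_times_Suc_imp by blast
qed

lemma smooth_add: "smooth f \<Longrightarrow> smooth g \<Longrightarrow> smooth (\<lambda>t. f t + g t)"
  by (simp add: smooth_iff_differentiable_times differentiable_times_add)

lemma smooth_cmult: "smooth f \<Longrightarrow> smooth (\<lambda>t. c * f t)"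
  by (simp add: smooth_iff_differentiable_times differentiable_times_cmult)

lemma smooth_bump0: "smooth (bump0 s t)"
proof -
  have "differentiable_times n (\<lambda>x. flat 0 (1 * x + (- s)) * flat 0 ((-1) * x + t))" for n
    by (intro differentiable_times_mult differentiable_times_affine differentiable_times_flat)
  then show ?thesis
    by (simp add: smooth_iff_differentiable_times bump0_def[abs_def])
qed

lemma smooth_bump: "smooth (bump s t)"
  using smooth_cmult[OF smooth_bump0] by (simp add: bump_def[abs_def])

lemma bump0_integral_pos: assumes "s < t" shows "0 < integral {s..t} (bump0 s t)"
proof -
  have c: "continuous_on {s..t} (bump0 s t)"
    by (rule smooth_imp_continuous_on[OF smooth_bump0])
  have nn: "\<forall>x\<in>{s..t}. 0 \<le> bump0 s t x"
    by (simp add: bump0_def flat_def)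
  have "integral {s..t} (bump0 s t) \<noteq> 0"
  proof
    assume "integral {s..t} (bump0 s t) = 0"
    then have "bump0 s t ((s + t) / 2) = 0"
      using integral_eq_0_iff[OF c assms] nn assms by auto
    then show False
      using assms by (simp add: bump0_def flat_def field_simps split: if_splits)
  qed
  moreover have "0 \<le> integral {s..t} (bump0 s t)"
    using nn by (intro integral_nonneg integrable_continuous_real c) auto
  ultimately show ?thesis by linarith
qed

lemma bump_nonneg: "s < t \<Longrightarrow> 0 \<le> bump s t x"
  using bump0_integral_pos[of s t] by (simp add: bump_def bump0_def flat_def)

lemma bump_eq_0: "x \<notin> {s<..<t} \<Longrightarrow> bump s t x = 0"
  by (auto simp: bump_def bump0_def flat_def)

lemma bump_has_integral: assumes "s < t" shows "(bump s t has_integral 1) {s..t}"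
proof -
  have "(bump0 s t has_integral integral {s..t} (bump0 s t)) {s..t}"
    by (intro integrable_integral integrable_continuous_real smooth_imp_continuous_on smooth_bump0)
  from has_integral_mult_right[OF this, of "inverse (integral {s..t} (bump0 s t))"]
  show ?thesis
    using bump0_integral_pos[OF assms] by (simp add: bump_def[abs_def])
qed

section \<open>Integration by parts for Henstock--Kurzweil integrals\<close>

text \<open>Only continuity of the indefinite integral \<open>P\<close> is available. For increasing \<open>\<phi>\<close> the second mean
  value theorem expresses \<open>\<integral> \<phi> u\<close> over \<open>[s,t]\<close> by the value of \<open>P\<close> at one point of \<open>[s,t]\<close>. Hence
  over \<open>[s,t]\<close> the defect \<open>D\<close> in the formula changes by at most the oscillation of \<open>P\<close> times
  \<open>\<phi> t - \<phi> s\<close>, which is \<open>o(t - s)\<close>; so \<open>D\<close> has derivative \<open>0\<close> and is constant.\<close>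

lemma HK_by_parts_mono:
  fixes u \<phi> \<phi>' :: "real \<Rightarrow> real"
  assumes u: "u integrable_on {a..d}"
    and \<phi>: "\<And>x. x \<in> {a..d} \<Longrightarrow> (\<phi> has_field_derivative \<phi>' x) (at x within {a..d})"
    and cont: "continuous_on {a..d} \<phi>'"
    and nonneg: "\<And>x. x \<in> {a..d} \<Longrightarrow> 0 \<le> \<phi>' x"
    and "a \<le> d"
  shows "((\<lambda>x. \<phi> x * u x) has_integral
           \<phi> d * integral {a..d} u - integral {a..d} (\<lambda>x. integral {a..x} u * \<phi>' x)) {a..d}"
proof -
  define P where "P x = integral {a..x} u" for x
  have contP: "continuous_on {a..d} P"
    unfolding P_def by (rule indefinite_integral_continuous_1[OF u])
  have FTC: "(\<phi>' has_integral \<phi> t - \<phi> s) {s..t}" if "a \<le> s" "s \<le> t" "t \<le> d" for s t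
    using that by (intro fundamental_theorem_of_calculus)
      (auto simp flip: has_real_derivative_iff_has_vector_derivative intro!: DERIV_subset[OF \<phi>])
  have mono: "\<phi> s \<le> \<phi> t" if "a \<le> s" "s \<le> t" "t \<le> d" for s t
    using has_integral_nonneg[OF FTC[OF that]] nonneg that by auto
  have contP\<phi>': "continuous_on {a..d} (\<lambda>x. P x * \<phi>' x)"
    by (intro continuous_intros contP cont)
  have P_diff: "integral {s..t} u = P t - P s" if "a \<le> s" "s \<le> t" "t \<le> d" for s t :: real
    using Henstock_Kurzweil_Integration.integral_combine[of a s t u]
      integrable_on_subinterval[OF u, of a t] that
    by (simp add: P_def)
  have ui: "u integrable_on {s..t}" if "a \<le> s" "t \<le> d" for s t
    using integrable_on_subinterval[OF u] that by auto
  have mv: "\<exists>c\<in>{s..t}. ((\<lambda>x. \<phi> x * u x) has_integral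
      (\<phi> t * P t - \<phi> s * P s - P c * (\<phi> t - \<phi> s))) {s..t}" if st: "a \<le> s" "s \<le> t" "t \<le> d" for s t
  proof -
    obtain c where c: "c \<in> {s..t}"
      "((\<lambda>x. \<phi> x * u x) has_integral (\<phi> s * integral {s..c} u + \<phi> t * integral {c..t} u)) {s..t}"
    proof (rule second_mean_value_theorem_full[OF ui[OF st(1,3)] st(2)])
      show "\<phi> x \<le> \<phi> y" if "s \<le> x" "x \<le> y" "y \<le> t" for x y
        using mono[of x y] st that by linarith
    qed
    have "\<phi> s * integral {s..c} u + \<phi> t * integral {c..t} u = 
        \<phi> t * P t - \<phi> s * P s - P c * (\<phi> t - \<phi> s)"
    proof -
      have "integral {s..c} u = P c - P s" "integral {c..t} u = P t - P c"
        using c(1) st by (auto intro!: P_diff)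
      then show ?thesis
        by (simp only:) (simp add: algebra_simps)
    qed
    then show ?thesis
      using c by auto
  qed
  have int_u: "(\<lambda>x. \<phi> x * u x) integrable_on {a..d}"
    using mv[of a d] \<open>a \<le> d\<close> by blast
  define D where "D t = integral {a..t} (\<lambda>x. \<phi> x * u x) - \<phi> t * P t
    + integral {a..t} (\<lambda>x. P x * \<phi>' x)" for t
  have D_diff: "\<exists>c\<in>{s..t}. D t - D s = integral {s..t} (\<lambda>x. (P x - P c) * \<phi>' x)"
    if st: "a \<le> s" "s \<le> t" "t \<le> d" for s t
  proof -
    obtain c where c: "c \<in> {s..t}" "((\<lambda>x. \<phi> x * u x) has_integral
      (\<phi> t * P t - \<phi> s * P s - P c * (\<phi> t - \<phi> s))) {s..t}"
      using mv[OF st] by blast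
    have 1: "integral {a..t} (\<lambda>x. \<phi> x * u x) =
        integral {a..s} (\<lambda>x. \<phi> x * u x) + integral {s..t} (\<lambda>x. \<phi> x * u x)"
      using Henstock_Kurzweil_Integration.integral_combine[of a s t "\<lambda>x. \<phi> x * u x"]
        integrable_on_subinterval[OF int_u, of a t] st by simp
    have i2: "(\<lambda>x. P x * \<phi>' x) integrable_on {x..y}" if "a \<le> x" "y \<le> d" for x y
      using that by (intro integrable_continuous_real continuous_on_subset[OF contP\<phi>']) auto
    have 2: "integral {a..t} (\<lambda>x. P x * \<phi>' x) =
        integral {a..s} (\<lambda>x. P x * \<phi>' x) + integral {s..t} (\<lambda>x. P x * \<phi>' x)"
      using Henstock_Kurzweil_Integration.integral_combine[of a s t "\<lambda>x. P x * \<phi>' x"]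
        i2[of a t] st by simp
    have 3: "integral {s..t} (\<lambda>x. (P x - P c) * \<phi>' x) =
        integral {s..t} (\<lambda>x. P x * \<phi>' x) - P c * (\<phi> t - \<phi> s)"
      unfolding left_diff_distrib
      using integral_unique[OF has_integral_diff[OF integrable_integral[OF i2[of s t]]
        has_integral_mult_right[OF FTC[OF st], of "P c"]]]
        st by simp
    show ?thesis
      using c(1) integral_unique[OF c(2)] 1 2 3 by (intro bexI[of _ c]) (auto simp: D_def)
  qed
  obtain B where B: "\<And>x. x \<in> {a..d} \<Longrightarrow> \<phi>' x \<le> B" "0 < B"
  proof -
    have "bounded (\<phi>' ` {a..d})"
      using compact_continuous_image[OF cont] compact_imp_bounded by blast
    then obtain B where B: "\<And>x. x \<in> {a..d} \<Longrightarrow> \<bar>\<phi>' x\<bar> \<le> B"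
      unfolding bounded_iff by (metis imageI real_norm_def)
    have "\<phi>' x \<le> max B 1" if "x \<in> {a..d}" for x
      using B[OF that] by linarith
    then show ?thesis
      by (rule that) auto
  qed
  have unif: "uniformly_continuous_on {a..d} P"
    using contP compact_uniformly_continuous by blast
  have "(D has_derivative (\<lambda>h. 0)) (at x within {a..d})" if x: "x \<in> {a..d}" for x
    unfolding has_derivative_within_alt
  proof (intro conjI allI impI)
    fix e :: real assume "0 < e"
    then obtain \<delta> where \<delta>: "0 < \<delta>"
      "\<And>y z. y \<in> {a..d} \<Longrightarrow> z \<in> {a..d} \<Longrightarrow> \<bar>y - z\<bar> < \<delta> \<Longrightarrow> \<bar>P y - P z\<bar> < e / B"
      using unif B(2) unfolding uniformly_continuous_on_def dist_real_def
      by (metis divide_pos_pos)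
    have key: "\<bar>D t - D s\<bar> \<le> e * (t - s)" if st: "a \<le> s" "s \<le> t" "t \<le> d" "t - s < \<delta>" for s t
    proof -
      obtain c where c: "c \<in> {s..t}" "D t - D s = integral {s..t} (\<lambda>x. (P x - P c) * \<phi>' x)"
        using D_diff[OF st(1-3)] by blast
      have "norm (integral {s..t} (\<lambda>x. (P x - P c) * \<phi>' x)) \<le> e * (t - s)"
      proof (rule integral_bound)
        show "continuous_on {s..t} (\<lambda>x. (P x - P c) * \<phi>' x)"
          using st by (intro continuous_intros continuous_on_subset[OF contP]
            continuous_on_subset[OF cont]) auto
        fix y assume y: "y \<in> {s..t}"
        have "\<bar>P y - P c\<bar> * \<bar>\<phi>' y\<bar> \<le> (e / B) * B"
          using \<delta>(2)[of y c] B nonneg y c(1) st \<open>0 < e\<close> by (intro mult_mono) fastforce+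
        then show "norm ((P y - P c) * \<phi>' y) \<le> e"
          using B(2) by (simp add: abs_mult)
      qed (use st in auto)
      then show ?thesis using c(2) by simp
    qed
    show "\<exists>\<delta>>0. \<forall>y\<in>{a..d}. norm (y - x) < \<delta> \<longrightarrow> norm (D y - D x - 0) \<le> e * norm (y - x)"
    proof (intro exI[of _ \<delta>] conjI ballI impI \<delta>(1))
      fix y assume "y \<in> {a..d}" "norm (y - x) < \<delta>"
      then show "norm (D y - D x - 0) \<le> e * norm (y - x)"
        using key[of x y] key[of y x] x by (cases "x \<le> y") (auto simp: abs_minus_commute)
    qed
  qed auto
  then obtain C where "\<And>x. x \<in> {a..d} \<Longrightarrow> D x = C"
    using has_derivative_zero_constant[of "{a..d}" D] by auto
  then have "D d = D a" using \<open>a \<le> d\<close> by simp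
  also have "\<dots> = 0" by (simp add: D_def P_def)
  finally have "integral {a..d} (\<lambda>x. \<phi> x * u x) = \<phi> d * P d - integral {a..d} (\<lambda>x. P x * \<phi>' x)"
    by (simp add: D_def)
  with int_u show ?thesis
    unfolding P_def by (metis integrable_integral)
qed

text \<open>Adding a large multiple of the identity makes \<open>\<phi>\<close> increasing, and the formula is linear in
  \<open>\<phi>\<close>.\<close>

lemma HK_by_parts:
  fixes u \<phi> \<phi>' :: "real \<Rightarrow> real"
  assumes u: "u integrable_on {a..d}"
    and \<phi>: "\<And>x. x \<in> {a..d} \<Longrightarrow> (\<phi> has_field_derivative \<phi>' x) (at x within {a..d})"
    and cont: "continuous_on {a..d} \<phi>'"
    and "a \<le> d"
  shows "((\<lambda>x. \<phi> x * u x) has_integral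
           \<phi> d * integral {a..d} u - integral {a..d} (\<lambda>x. integral {a..x} u * \<phi>' x)) {a..d}"
proof -
  define P where "P x = integral {a..x} u" for x
  have contP: "continuous_on {a..d} P"
    unfolding P_def by (rule indefinite_integral_continuous_1[OF u])
  have "bounded (\<phi>' ` {a..d})"
    using compact_continuous_image[OF cont] compact_imp_bounded by blast
  then obtain L where L: "\<And>x. x \<in> {a..d} \<Longrightarrow> \<bar>\<phi>' x\<bar> \<le> L"
    unfolding bounded_iff by (metis imageI real_norm_def)
  then have "0 \<le> L" using \<open>a \<le> d\<close> by (meson abs_ge_zero atLeastAtMost_iff order.refl order_trans)
  have 1: "((\<lambda>x. (\<phi> x + L * x) * u x) has_integral
           (\<phi> d + L * d) * P d - integral {a..d} (\<lambda>x. P x * (\<phi>' x + L))) {a..d}"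
    unfolding P_def
    by (rule HK_by_parts_mono[OF u])
       (use L \<open>a \<le> d\<close> in \<open>auto intro!: derivative_eq_intros \<phi> continuous_intros cont
          dest: abs_le_D2 simp: add.commute\<close>, force)
  have 2: "((\<lambda>x. (L * x) * u x) has_integral
           (L * d) * P d - integral {a..d} (\<lambda>x. P x * L)) {a..d}"
    unfolding P_def
    by (rule HK_by_parts_mono[OF u])
       (use \<open>0 \<le> L\<close> \<open>a \<le> d\<close> in \<open>auto intro!: derivative_eq_intros continuous_intros\<close>)
  have "integral {a..d} (\<lambda>x. P x * (\<phi>' x + L)) - integral {a..d} (\<lambda>x. P x * L) =
      integral {a..d} (\<lambda>x. P x * \<phi>' x)"
    by (subst integral_diff[symmetric])
       (auto intro!: integrable_continuous_real continuous_intros contP cont simp: algebra_simps)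
  with has_integral_diff[OF 1 2] show ?thesis
    by (simp add: P_def algebra_simps)
qed

section \<open>Pairing with test functions\<close>

lemma Iv_nonneg: "t \<in> Iv b \<Longrightarrow> 0 \<le> t"
  by (simp add: Iv_def)

lemma Iv_zero: "0 < b \<Longrightarrow> 0 \<in> Iv b"
  by (simp add: Iv_def zero_ereal_def)

lemma Icc_subset_Iv: "0 \<le> s \<Longrightarrow> t \<in> Iv b \<Longrightarrow> {s..t} \<subseteq> Iv b"
  by (auto simp: Iv_def intro: le_less_trans[of _ "ereal t"])

lemma Iv_exists_greater: "t \<in> Iv b \<Longrightarrow> \<exists>d\<in>Iv b. t < d"
  using ereal_dense2[of "ereal t" b] by (auto simp: Iv_def intro: less_imp_le order_trans)

lemma HK_integrable_Icc: "H \<in> HK_functions b \<Longrightarrow> 0 \<le> s \<Longrightarrow> t \<in> Iv b \<Longrightarrow> H integrable_on {s..t}"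
  by (simp add: HK_functions_def Icc_subset_Iv)

lemma test_functionsI:
  assumes "smooth \<phi>" "0 \<le> s" "t \<in> Iv b" "\<And>x. x \<notin> {s..t} \<Longrightarrow> \<phi> x = 0"
  shows "\<phi> \<in> test_functions b"
proof -
  have "supp \<phi> \<subseteq> {s..t}"
    unfolding supp_def using assms(4) by (intro closure_minimal) blast+
  then show ?thesis
    using assms Icc_subset_Iv[OF assms(2,3)] compact_Int_closed[of "{s..t}" "supp \<phi>"]
    by (auto simp: test_functions_def Int_absorb1 supp_def[of \<phi>])
qed

text \<open>The support lies in \<open>[0,b)\<close>, so a test function vanishes to the left of \<open>0\<close> and, by continuity,
  at \<open>0\<close>: there are no boundary terms at either end.\<close>

lemma test_functions_vanish_outside:
  assumes "\<phi> \<in> test_functions b" "0 < b"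
  obtains d where "d \<in> Iv b" "0 < d" "\<And>x. x \<notin> {0<..<d} \<Longrightarrow> \<phi> x = 0"
proof -
  have sub: "supp \<phi> \<subseteq> Iv b" and cpt: "compact (supp \<phi>)" and sm: "smooth \<phi>"
    using assms by (auto simp: test_functions_def)
  have out: "\<phi> x = 0" if "x \<notin> supp \<phi>" for x
    using that closure_subset[of "{t. \<phi> t \<noteq> 0}"] by (auto simp: supp_def)
  obtain e where e: "e \<in> Iv b" "supp \<phi> \<subseteq> {..e}"
  proof (cases "supp \<phi> = {}")
    case True
    then show ?thesis using that Iv_zero[OF assms(2)] by simp
  next
    case False
    then obtain e where "e \<in> supp \<phi>" "\<And>x. x \<in> supp \<phi> \<Longrightarrow> x \<le> e"
      using compact_attains_sup[OF cpt] by blast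
    then show ?thesis using sub by (intro that[of e]) auto
  qed
  obtain d where d: "d \<in> Iv b" "e < d" using Iv_exists_greater[OF e(1)] by blast
  have "\<phi> 0 = 0"
  proof -
    have "(\<phi> \<longlongrightarrow> \<phi> 0) (at_left 0)"
      using smooth_imp_continuous_on[OF sm, of UNIV]
      by (meson UNIV_I continuous_on_eq_continuous_at continuous_within isContD open_UNIV
          tendsto_within_subset top_greatest)
    moreover have "(\<phi> \<longlongrightarrow> 0) (at_left 0)"
      using sub by (intro tendsto_eventually) 
        (auto simp: eventually_at_filter Iv_def intro!: always_eventually out)
    ultimately show ?thesis using tendsto_unique trivial_limit_at_left_real by blast
  qed
  then have "\<phi> x = 0" if "x \<notin> {0<..<d}" for x
  proof (cases "x \<in> supp \<phi>")
    case True
    with that have "x = 0"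
      using d(2) e(2) sub by (force simp: Iv_def)
    then show ?thesis using \<open>\<phi> 0 = 0\<close> by simp
  qed (rule out)
  moreover have "0 < d" using d e(1) by (auto simp: Iv_def)
  ultimately show ?thesis using that d(1) by blast
qed

lemma test_functions_deriv:
  assumes "\<phi> \<in> test_functions b"
  shows "deriv \<phi> \<in> test_functions b"
proof -
  have "deriv \<phi> x = 0" if "x \<notin> supp \<phi>" for x
  proof -
    have "((\<lambda>x. 0) has_field_derivative 0) (at x)" by simp
    then have "(\<phi> has_field_derivative 0) (at x)"
    proof (rule has_field_derivative_transform_within_open)
      show "open (- supp \<phi>)" by (simp add: supp_def open_Compl)
      show "0 = \<phi> y" if "y \<in> - supp \<phi>" for y
        using that closure_subset[of "{t. \<phi> t \<noteq> 0}"] by (auto simp: supp_def)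
    qed (use that in auto)
    then show ?thesis by (rule DERIV_imp_deriv)
  qed
  then have "supp (deriv \<phi>) \<subseteq> supp \<phi>"
    unfolding supp_def[of "deriv \<phi>"] by (intro closure_minimal) (auto simp: supp_def)
  then show ?thesis
    using assms smooth_deriv compact_Int_closed[of "supp \<phi>" "supp (deriv \<phi>)"]
    by (auto simp: test_functions_def Int_absorb1 supp_def[of "deriv \<phi>"])
qed

text \<open>Multiplication by a smooth function preserves Henstock--Kurzweil integrability, as part of
  integration by parts.\<close>

lemma has_integral_dist_of:
  assumes "H \<in> HK_functions b" "smooth \<phi>" "0 \<le> s" "s \<le> t" "t \<in> Iv b" "\<And>x. x \<notin> {s..t} \<Longrightarrow> \<phi> x = 0"
  shows "((\<lambda>x. \<phi> x * H x) has_integral dist_of b H \<phi>) {s..t}"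
    and "(\<lambda>x. H x * \<phi> x) integrable_on Iv b"
proof -
  have "(\<lambda>x. \<phi> x * H x) integrable_on {s..t}"
  proof (rule has_integral_integrable[OF HK_by_parts])
    show "H integrable_on {s..t}" using HK_integrable_Icc assms by blast
    show "(\<phi> has_field_derivative deriv \<phi> x) (at x within {s..t})" for x
      by (rule smooth_has_derivative[OF assms(2)])
    show "continuous_on {s..t} (deriv \<phi>)"
      using assms(2) smooth_deriv smooth_imp_continuous_on by blast
  qed fact
  then have 1: "((\<lambda>x. \<phi> x * H x) has_integral integral {s..t} (\<lambda>x. \<phi> x * H x)) {s..t}"
    by (rule integrable_integral)
  have 2: "((\<lambda>x. H x * \<phi> x) has_integral integral {s..t} (\<lambda>x. \<phi> x * H x)) (Iv b)"
  proof (rule has_integral_on_superset)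
    show "((\<lambda>x. H x * \<phi> x) has_integral integral {s..t} (\<lambda>x. \<phi> x * H x)) {s..t}"
      using 1 by (simp add: mult.commute)
    show "H x * \<phi> x = 0" if "x \<notin> {s..t}" for x
      by (simp add: assms(6)[OF that])
  qed (rule Icc_subset_Iv[OF assms(3,5)])
  then show "(\<lambda>x. H x * \<phi> x) integrable_on Iv b" by blast
  have "\<phi> \<in> test_functions b" using assms test_functionsI by blast
  then show "((\<lambda>x. \<phi> x * H x) has_integral dist_of b H \<phi>) {s..t}"
    using 1 integral_unique[OF 2] by (simp add: dist_of_def)
qed

section \<open>Indefinite integrals as distributional primitives\<close>

definition primitive :: "ereal \<Rightarrow> real \<Rightarrow> (real \<Rightarrow> real) \<Rightarrow> real \<Rightarrow> real" where
  "primitive b c u = (\<lambda>t\<in>Iv b. c + integral {0..t} u)"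

lemma D_lcI:
  assumes "F \<in> extensional (Iv b)" "\<And>d. d \<in> Iv b \<Longrightarrow> continuous_on {0..d} F" "0 < b"
  shows "F \<in> D_lc b"
proof -
  have "F integrable_on {a..d}" if "{a..d} \<subseteq> Iv b" for a d
  proof (cases "a \<le> d")
    case True
    then have "0 \<le> a" "d \<in> Iv b" using that by (auto simp: Iv_def subset_iff)
    then show ?thesis
      using assms(2)[of d] by (intro integrable_continuous_real) (auto elim: continuous_on_subset)
  qed (simp add: integrable_on_empty)
  moreover have "continuous (at_right 0) F"
  proof -
    obtain d where "d \<in> Iv b" "0 < d" using Iv_exists_greater Iv_zero assms(3) by blast
    then show ?thesis
      using continuous_on_Icc_at_rightD[of 0 d F] assms(2) by (simp add: continuous_within)
  qed
  moreover have "continuous (at_left t) F" if "t \<in> Iv b" "0 < t" for t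
    using continuous_on_Icc_at_leftD[of 0 t F] assms(2) that by (simp add: continuous_within)
  ultimately show ?thesis using assms(1) by (auto simp: D_lc_def HK_functions_def)
qed

lemma D_lc_subset_HK: "F \<in> D_lc b \<Longrightarrow> F \<in> HK_functions b"
  by (simp add: D_lc_def)

lemma primitive_in_D_lc:
  assumes "u \<in> HK_functions b" "0 < b"
  shows "primitive b c u \<in> D_lc b"
proof (rule D_lcI)
  fix d assume d: "d \<in> Iv b"
  have "continuous_on {0..d} (\<lambda>t. c + integral {0..t} u)"
    using HK_integrable_Icc[OF assms(1) _ d, of 0]
    by (intro continuous_intros indefinite_integral_continuous_1) auto
  then show "continuous_on {0..d} (primitive b c u)"
    using Icc_subset_Iv[OF order.refl d] by (elim continuous_on_eq) (auto simp: primitive_def)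
qed (use assms in \<open>auto simp: primitive_def\<close>)

lemma dist_deriv_primitive:
  assumes u: "u \<in> HK_functions b" and b: "0 < b"
  shows "dist_deriv b (dist_of b (primitive b c u)) = dist_of b u"
proof
  fix \<phi>
  show "dist_deriv b (dist_of b (primitive b c u)) \<phi> = dist_of b u \<phi>"
  proof (cases "\<phi> \<in> test_functions b")
    case True
    obtain d where d: "d \<in> Iv b" "0 < d" and vanish: "\<And>x. x \<notin> {0<..<d} \<Longrightarrow> \<phi> x = 0"
      using test_functions_vanish_outside[OF True b] by blast
    have sm: "smooth \<phi>" using True by (simp add: test_functions_def)
    have D: "(\<phi> has_field_derivative deriv \<phi> x) (at x within A)" for x A
      by (rule smooth_has_derivative[OF sm])
    have cont: "continuous_on A (deriv \<phi>)" for A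
      using sm smooth_deriv smooth_imp_continuous_on by blast
    have ui: "u integrable_on {0..d}" using HK_integrable_Icc[OF u _ d(1)] by simp
    have vanish': "deriv \<phi> x = 0" if "x \<notin> {0..d}" for x
    proof -
      have "(\<phi> has_field_derivative 0) (at x)"
        by (rule has_field_derivative_transform_within_open[of "\<lambda>x. 0" 0 x "- {0..d}"])
           (use that vanish in \<open>auto simp: open_Compl\<close>)
      then show ?thesis by (rule DERIV_imp_deriv)
    qed
    have "((\<lambda>x. \<phi> x * u x) has_integral - integral {0..d} (\<lambda>x. integral {0..x} u * deriv \<phi> x)) {0..d}"
      using HK_by_parts[OF ui D cont] d(2) vanish[of d] by simp
    moreover have "((\<lambda>x. \<phi> x * u x) has_integral dist_of b u \<phi>) {0..d}"
      using vanish d by (intro has_integral_dist_of u sm) auto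
    ultimately have 1: "dist_of b u \<phi> = - integral {0..d} (\<lambda>x. integral {0..x} u * deriv \<phi> x)"
      by (rule has_integral_unique[rotated])
    have "((\<lambda>x. deriv \<phi> x * primitive b c u x) has_integral dist_of b (primitive b c u) (deriv \<phi>)) {0..d}"
      using d vanish' sm
      by (intro has_integral_dist_of D_lc_subset_HK primitive_in_D_lc u b smooth_deriv) auto
    moreover have "((\<lambda>x. deriv \<phi> x * primitive b c u x) has_integral
          c * (\<phi> d - \<phi> 0) + integral {0..d} (\<lambda>x. integral {0..x} u * deriv \<phi> x)) {0..d}"
    proof (rule has_integral_eq[OF _ has_integral_add])
      show "((\<lambda>x. c * deriv \<phi> x) has_integral c * (\<phi> d - \<phi> 0)) {0..d}"
        using d(2) D by (intro has_integral_mult_right fundamental_theorem_of_calculus)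
          (auto simp flip: has_real_derivative_iff_has_vector_derivative)
      show "((\<lambda>x. integral {0..x} u * deriv \<phi> x) has_integral
              integral {0..d} (\<lambda>x. integral {0..x} u * deriv \<phi> x)) {0..d}"
        by (intro integrable_integral integrable_continuous_real continuous_intros cont
            indefinite_integral_continuous_1 ui)
      show "c * deriv \<phi> x + integral {0..x} u * deriv \<phi> x = deriv \<phi> x * primitive b c u x"
        if "x \<in> {0..d}" for x
        using that Icc_subset_Iv[OF order.refl d(1)] by (auto simp: primitive_def algebra_simps)
    qed
    ultimately have "dist_of b (primitive b c u) (deriv \<phi>) =
        c * (\<phi> d - \<phi> 0) + integral {0..d} (\<lambda>x. integral {0..x} u * deriv \<phi> x)"
      by (rule has_integral_unique)
    with 1 True show ?thesis
      using vanish[of d] vanish[of 0] by (simp add: dist_deriv_def)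
  qed (simp add: dist_deriv_def dist_of_def)
qed

lemma D_lc_tendsto_left: "F \<in> D_lc b \<Longrightarrow> t \<in> Iv b \<Longrightarrow> 0 < t \<Longrightarrow> (F \<longlongrightarrow> F t) (at_left t)"
  by (simp add: D_lc_def continuous_within)

lemma D_lc_tendsto_right: "F \<in> D_lc b \<Longrightarrow> (F \<longlongrightarrow> F 0) (at_right 0)"
  by (simp add: D_lc_def continuous_within)

section \<open>Recovering a one-sided continuous function from its distribution\<close>

lemma bump_test_function:
  "0 \<le> s \<Longrightarrow> t \<in> Iv b \<Longrightarrow> bump s t \<in> test_functions b"
  using bump_eq_0[of _ s t] by (intro test_functionsI[of _ s t] smooth_bump) auto

text \<open>The bump on \<open>[s,t]\<close> has integral \<open>1\<close> and sees only values of \<open>F\<close> to the left of \<open>t\<close>, where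
  \<open>F\<close> is close to \<open>F t\<close>.\<close>

lemma dist_of_bump_tendsto:
  assumes F: "F \<in> D_lc b" and t: "t \<in> Iv b" "0 < t"
  shows "((\<lambda>s. dist_of b F (bump s t)) \<longlongrightarrow> F t) (at_left t)"
proof (rule tendstoI)
  fix e :: real assume "0 < e"
  then have "\<forall>\<^sub>F x in at_left t. \<bar>F x - F t\<bar> < e / 2"
    using tendstoD[OF D_lc_tendsto_left[OF F t], of "e / 2"] by (simp add: dist_real_def)
  then obtain s0 where s0: "s0 < t" "\<And>x. s0 < x \<Longrightarrow> x < t \<Longrightarrow> \<bar>F x - F t\<bar> < e / 2"
    unfolding eventually_at_left_field by blast
  have "dist (dist_of b F (bump s t)) (F t) < e" if s: "max 0 s0 < s" "s < t" for s
  proof -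
    have I: "((\<lambda>x. bump s t x * F x) has_integral dist_of b F (bump s t)) {s..t}"
      using s t bump_eq_0[of _ s t] by (intro has_integral_dist_of D_lc_subset_HK F smooth_bump) auto
    have B: "((\<lambda>x. bump s t x * k) has_integral k) {s..t}" for k
      using has_integral_mult_left[OF bump_has_integral[OF s(2)], of k] by simp
    have le: "bump s t x * (F t - e / 2) \<le> bump s t x * F x" 
         "bump s t x * F x \<le> bump s t x * (F t + e / 2)" for x
    proof -
      have "bump s t x * (F t - e / 2) \<le> bump s t x * F x \<and> bump s t x * F x \<le> bump s t x * (F t + e / 2)"
      proof (cases "x \<in> {s<..<t}")
        case True
        show ?thesis
        proof (intro conjI mult_left_mono bump_nonneg[OF s(2)])
          have "\<bar>F x - F t\<bar> < e / 2" using True s by (intro s0(2)) auto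
          then show "F t - e / 2 \<le> F x" "F x \<le> F t + e / 2" by linarith+
        qed
      qed (simp add: bump_eq_0)
      then show "bump s t x * (F t - e / 2) \<le> bump s t x * F x" 
         "bump s t x * F x \<le> bump s t x * (F t + e / 2)" by auto
    qed
    have "F t - e / 2 \<le> dist_of b F (bump s t)" "dist_of b F (bump s t) \<le> F t + e / 2"
      using has_integral_le[OF B I] has_integral_le[OF I B] le by blast+
    then have "\<bar>dist_of b F (bump s t) - F t\<bar> \<le> e / 2" by linarith
    then show ?thesis using \<open>0 < e\<close> by (simp add: dist_real_def)
  qed
  then show "\<forall>\<^sub>F s in at_left t. dist (dist_of b F (bump s t)) (F t) < e"
    unfolding eventually_at_left_field using s0(1) t(2) by (intro exI[of _ "max 0 s0"]) auto
qed

lemma D_lc_diff_const_at_0: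
  assumes "F \<in> D_lc b" "G \<in> D_lc b" "0 < b" "\<And>t. t \<in> Iv b \<Longrightarrow> 0 < t \<Longrightarrow> F t - G t = k"
  shows "F 0 - G 0 = k"
proof -
  obtain d where d: "d \<in> Iv b" "0 < d" using Iv_exists_greater[OF Iv_zero[OF assms(3)]] by blast
  have "\<forall>\<^sub>F t in at_right 0. F t - G t = k"
    unfolding eventually_at_right_field
    using d assms(4) Icc_subset_Iv[OF order.refl d(1)] by (intro exI[of _ d]) (auto simp: subset_iff)
  then have "((\<lambda>t. F t - G t) \<longlongrightarrow> k) (at_right 0)" by (rule tendsto_eventually)
  moreover have "((\<lambda>t. F t - G t) \<longlongrightarrow> F 0 - G 0) (at_right 0)"
    by (intro tendsto_diff D_lc_tendsto_right[OF assms(1)] D_lc_tendsto_right[OF assms(2)])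
  ultimately show ?thesis using tendsto_unique trivial_limit_at_right_real by blast
qed

text \<open>The constant \<open>k\<close> serves two purposes: \<open>k = 0\<close> gives equality of functions with equal
  distributions, general \<open>k\<close> uniqueness of primitives up to a constant.\<close>

lemma D_lc_eqI_bumps:
  assumes F: "F \<in> D_lc b" and G: "G \<in> D_lc b" and b: "0 < b"
    and bumps: "\<And>s t. 0 \<le> s \<Longrightarrow> s < t \<Longrightarrow> t \<in> Iv b \<Longrightarrow>
      dist_of b F (bump s t) - dist_of b G (bump s t) = k"
    and t: "t \<in> Iv b"
  shows "F t - G t = k"
proof -
  have pos: "F t - G t = k" if t: "t \<in> Iv b" "0 < t" for t
  proof -
    have "((\<lambda>s. dist_of b F (bump s t) - dist_of b G (bump s t)) \<longlongrightarrow> F t - G t) (at_left t)"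
      by (intro tendsto_diff dist_of_bump_tendsto F G t)
    moreover have "\<forall>\<^sub>F s in at_left t. dist_of b F (bump s t) - dist_of b G (bump s t) = k"
      unfolding eventually_at_left_field using t bumps by (intro exI[of _ 0]) auto
    then have "((\<lambda>s. dist_of b F (bump s t) - dist_of b G (bump s t)) \<longlongrightarrow> k) (at_left t)"
      by (rule tendsto_eventually)
    ultimately show ?thesis using tendsto_unique trivial_limit_at_left_real by blast
  qed
  then show ?thesis
    using D_lc_diff_const_at_0[OF F G b pos] t by (cases "t = 0") (auto simp: Iv_def)
qed

lemma dist_of_inj:
  assumes "F \<in> D_lc b" "G \<in> D_lc b" "0 < b" "dist_of b F = dist_of b G"
  shows "F = G"
proof (rule extensionalityI[of _ "Iv b"])
  show "F \<in> extensional (Iv b)" "G \<in> extensional (Iv b)"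
    using assms by (auto simp: D_lc_def HK_functions_def)
  show "F t = G t" if "t \<in> Iv b" for t
    using D_lc_eqI_bumps[of F b G 0 t] assms that by simp
qed

text \<open>Both bumps have integral \<open>1\<close>, so the antiderivative of their difference that vanishes on the left
  also vanishes on the right.\<close>

lemma bump_antiderivative:
  assumes "0 \<le> s" "s < t" "t \<in> Iv b" "0 \<le> s'" "s' < t'" "t' \<in> Iv b"
  obtains \<psi> where "\<psi> \<in> test_functions b" "deriv \<psi> = (\<lambda>x. bump s t x - bump s' t' x)"
proof
  define h where "h x = bump s t x + (-1) * bump s' t' x" for x
  \<comment> \<open>Starting at \<open>-1\<close> makes \<open>0\<close> an interior point of the domain of integration.\<close>
  define \<psi> where "\<psi> x = integral {-1..x} h" for x
  have sm: "smooth h" unfolding h_def by (intro smooth_add smooth_cmult smooth_bump)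
  have h0: "h x = 0" if "x \<le> 0" for x
    using that assms by (simp add: h_def bump_eq_0)
  have \<psi>0: "\<psi> x = 0" if "x \<le> 0" for x
  proof -
    have "(h has_integral 0) {-1..x}" using that by (intro has_integral_is_0) (auto intro: h0)
    then show ?thesis by (simp add: \<psi>_def integral_unique)
  qed
  have D: "(\<psi> has_field_derivative h x) (at x)" for x
  proof (cases "x < 0")
    case True
    show ?thesis
      by (rule has_field_derivative_transform_within_open[of "\<lambda>x. 0" _ x "{..<0}"])
         (use True \<psi>0 h0 in auto)
  next
    case False
    then have "(\<psi> has_field_derivative h x) (at x within {-1..x + 1})"
      unfolding \<psi>_def by (intro integral_has_real_derivative smooth_imp_continuous_on sm) auto
    moreover have "at x within {-1..x + 1} = at x"
      using False by (intro at_within_Icc_at) auto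
    ultimately show ?thesis by simp
  qed
  show "deriv \<psi> = (\<lambda>x. bump s t x - bump s' t' x)"
    using D by (auto simp: DERIV_imp_deriv h_def)
  show "\<psi> \<in> test_functions b"
  proof (rule test_functionsI)
    show "smooth \<psi>" using D sm by (rule smooth_antiderivative)
    show "max t t' \<in> Iv b" using assms by (simp add: max_def)
    fix x assume x: "x \<notin> {0..max t t'}"
    show "\<psi> x = 0"
    proof (cases "x \<le> 0")
      case False
      have I: "(bump p q has_integral 1) {-1..x}" if "0 \<le> p" "p < q" "q \<le> x" for p q
      proof (rule has_integral_on_superset[OF bump_has_integral])
        show "bump p q y = 0" if "y \<notin> {p..q}" for y
          using that by (intro bump_eq_0) auto
      qed (use that in auto)
      have "(bump s t has_integral 1) {-1..x}" "(bump s' t' has_integral 1) {-1..x}"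
        using x False assms by (auto intro!: I)
      from has_integral_add[OF this(1) has_integral_mult_right[OF this(2), of "-1"]]
      show ?thesis by (simp add: \<psi>_def h_def[abs_def] integral_unique)
    qed (rule \<psi>0)
  qed simp
qed

lemma dist_of_diff:
  assumes "H \<in> HK_functions b" "\<phi> \<in> test_functions b" "\<psi> \<in> test_functions b" "0 < b"
    "(\<lambda>x. \<phi> x - \<psi> x) \<in> test_functions b"
  shows "dist_of b H (\<lambda>x. \<phi> x - \<psi> x) = dist_of b H \<phi> - dist_of b H \<psi>"
proof -
  have "(\<lambda>x. H x * \<phi> x) integrable_on Iv b" if \<phi>: "\<phi> \<in> test_functions b" for \<phi>
  proof -
    obtain d where "d \<in> Iv b" "0 < d" "\<And>x. x \<notin> {0<..<d} \<Longrightarrow> \<phi> x = 0"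
      using test_functions_vanish_outside[OF \<phi> assms(4)] by blast
    then show ?thesis
      using assms(1) \<phi> by (intro has_integral_dist_of(2)[of _ _ _ 0 d]) (auto simp: test_functions_def)
  qed
  then show ?thesis
    using assms by (simp add: dist_of_def right_diff_distrib integral_diff)
qed

text \<open>Testing the equality with an antiderivative of a difference of two bumps shows that \<open>F\<close> and \<open>G\<close>
  have distributions whose difference takes the same value on all unit bumps.\<close>

lemma dist_deriv_eq_imp_diff_const:
  assumes F: "F \<in> D_lc b" and G: "G \<in> D_lc b" and b: "0 < b"
    and eq: "dist_deriv b (dist_of b F) = dist_deriv b (dist_of b G)" and x: "x \<in> Iv b"
  shows "F x - F 0 = G x - G 0"
proof -
  obtain d where d: "d \<in> Iv b" "0 < d" using Iv_exists_greater[OF Iv_zero[OF b]] by blast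
  define k where "k = dist_of b F (bump 0 d) - dist_of b G (bump 0 d)"
  have "dist_of b F (bump s t) - dist_of b G (bump s t) = k" if st: "0 \<le> s" "s < t" "t \<in> Iv b" for s t
  proof -
    obtain \<psi> where \<psi>: "\<psi> \<in> test_functions b" "deriv \<psi> = (\<lambda>x. bump s t x - bump 0 d x)"
      using bump_antiderivative[OF st _ d(2,1)] by blast
    have "dist_of b H (deriv \<psi>) = dist_of b H (bump s t) - dist_of b H (bump 0 d)" if "H \<in> D_lc b" for H
      unfolding \<psi>(2)
      using test_functions_deriv[OF \<psi>(1)] st d that \<psi>(2)
      by (intro dist_of_diff D_lc_subset_HK bump_test_function b) auto
    moreover have "dist_of b F (deriv \<psi>) = dist_of b G (deriv \<psi>)"
      using fun_cong[OF eq, of \<psi>] \<psi>(1) by (simp add: dist_deriv_def)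
    ultimately show ?thesis using F G by (simp add: k_def)
  qed
  then have "F t - G t = k" if "t \<in> Iv b" for t
    using D_lc_eqI_bumps[OF F G b] that by blast
  from this[OF x] this[OF Iv_zero[OF b]] show ?thesis by linarith
qed

lemma AE_lebesgue_imp_ex_between:
  assumes "AE x in lebesgue. P x" "s < (t::real)"
  shows "\<exists>x. s < x \<and> x < t \<and> P x"
proof (rule ccontr)
  assume *: "\<not> ?thesis"
  obtain N where "{x \<in> space lebesgue. \<not> P x} \<subseteq> N" "N \<in> null_sets lebesgue"
    using assms(1) unfolding eventually_ae_filter by blast
  with * have "negligible N" "{s<..<t} \<subseteq> N"
    by (auto simp: negligible_iff_null_sets)
  then have "negligible {s<..<t}"
    by (rule negligible_subset)
  then show False
    using open_not_negligible[of "{s<..<t}"] assms(2) by auto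
qed

text \<open>A strict inequality \<open>G t < F t\<close> would persist on an interval to the left of \<open>t\<close>, or to the right
  if \<open>t = 0\<close>.\<close>

lemma D_lc_AE_le_imp_le:
  assumes F: "F \<in> D_lc b" and G: "G \<in> D_lc b" and b: "0 < b"
    and AE: "AE x in lebesgue. x \<in> Iv b \<longrightarrow> F x \<le> G x" and t: "t \<in> Iv b"
  shows "F t \<le> G t"
proof (rule ccontr)
  assume "\<not> F t \<le> G t"
  then have lt: "G t < F t" by simp
  have "\<exists>s d. s < d \<and> (\<forall>x. s < x \<longrightarrow> x < d \<longrightarrow> x \<in> Iv b \<and> G x < F x)"
  proof (cases "t = 0")
    case True
    obtain d where d: "d \<in> Iv b" "0 < d" using Iv_exists_greater[OF Iv_zero[OF b]] by blast
    have "\<forall>\<^sub>F x in at_right 0. 0 < F x - G x"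
      using lt True tendsto_diff[OF D_lc_tendsto_right[OF F] D_lc_tendsto_right[OF G]]
      by (intro order_tendstoD) auto
    then obtain e where "0 < e" "\<And>x. 0 < x \<Longrightarrow> x < e \<Longrightarrow> G x < F x"
      unfolding eventually_at_right_field by auto
    then show ?thesis
      using d Icc_subset_Iv[OF order.refl d(1)] by (intro exI[of _ 0] exI[of _ "min d e"])
        (auto simp: subset_iff)
  next
    case False
    then have t0: "0 < t" using t by (simp add: Iv_def)
    have "\<forall>\<^sub>F x in at_left t. 0 < F x - G x"
      using lt tendsto_diff[OF D_lc_tendsto_left[OF F t t0] D_lc_tendsto_left[OF G t t0]]
      by (intro order_tendstoD) auto
    then obtain e where "e < t" "\<And>x. e < x \<Longrightarrow> x < t \<Longrightarrow> G x < F x"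
      unfolding eventually_at_left_field by auto
    then show ?thesis
      using t0 Icc_subset_Iv[OF order.refl t] by (intro exI[of _ "max 0 e"] exI[of _ t])
        (auto simp: subset_iff)
  qed
  then show False
    using AE_lebesgue_imp_ex_between[OF AE] by (meson not_le)
qed

section \<open>Jets determined by initial values and the highest derivative\<close>

text \<open>Distributional primitives are normalised to prescribed initial values by adding constants.\<close>

lemma D_lc_add_const:
  assumes F: "F \<in> D_lc b" and b: "0 < b"
  shows "(\<lambda>t\<in>Iv b. k + F t) \<in> D_lc b"
proof -
  let ?G = "\<lambda>t\<in>Iv b. k + F t"
  have "?G \<in> HK_functions b"
  proof -
    have "?G integrable_on {a..d}" if "{a..d} \<subseteq> Iv b" for a d
    proof (rule integrable_eq)
      show "(\<lambda>t. k + F t) integrable_on {a..d}"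
        using F that by (intro integrable_add integrable_const_ivl) (auto simp: D_lc_def HK_functions_def)
    qed (use that in auto)
    then show ?thesis by (simp add: HK_functions_def)
  qed
  moreover have "(?G \<longlongrightarrow> ?G 0) (at_right 0)"
  proof (rule Lim_transform_eventually)
    show "((\<lambda>t. k + F t) \<longlongrightarrow> ?G 0) (at_right 0)"
      using Iv_zero[OF b] D_lc_tendsto_right[OF F] by (auto intro: tendsto_add)
    obtain d where "d \<in> Iv b" "0 < d" using Iv_exists_greater[OF Iv_zero[OF b]] by blast
    then show "\<forall>\<^sub>F t in at_right 0. k + F t = ?G t"
      unfolding eventually_at_right_field
      using Icc_subset_Iv[of 0 d b] by (intro exI[of _ d]) (auto simp: subset_iff)
  qed
  moreover have "(?G \<longlongrightarrow> ?G t) (at_left t)" if t: "t \<in> Iv b" "0 < t" for t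
  proof (rule Lim_transform_eventually)
    show "((\<lambda>t. k + F t) \<longlongrightarrow> ?G t) (at_left t)"
      using t D_lc_tendsto_left[OF F t] by (auto intro: tendsto_add)
    show "\<forall>\<^sub>F s in at_left t. k + F s = ?G s"
      unfolding eventually_at_left_field
      using t Icc_subset_Iv[of 0 t b] by (intro exI[of _ 0]) (auto simp: subset_iff)
  qed
  ultimately show ?thesis
    by (simp add: D_lc_def continuous_within)
qed

lemma dist_deriv_add_const:
  assumes F: "F \<in> D_lc b" and b: "0 < b"
  shows "dist_deriv b (dist_of b (\<lambda>t\<in>Iv b. k + F t)) = dist_deriv b (dist_of b F)"
proof
  fix \<phi>
  show "dist_deriv b (dist_of b (\<lambda>t\<in>Iv b. k + F t)) \<phi> = dist_deriv b (dist_of b F) \<phi>"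
  proof (cases "\<phi> \<in> test_functions b")
    case True
    obtain d where d: "d \<in> Iv b" "0 < d" and out: "\<And>x. x \<notin> {0<..<d} \<Longrightarrow> \<phi> x = 0"
      using test_functions_vanish_outside[OF True b] by blast
    obtain d' where d': "d' \<in> Iv b" "0 < d'" and out': "\<And>x. x \<notin> {0<..<d'} \<Longrightarrow> deriv \<phi> x = 0"
      using test_functions_vanish_outside[OF test_functions_deriv[OF True] b] by blast
    define e where "e = max d d'"
    have e: "e \<in> Iv b" "0 < e" using d d' by (auto simp: e_def max_def)
    have sm: "smooth \<phi>" using True by (simp add: test_functions_def)
    have D: "(\<phi> has_field_derivative deriv \<phi> x) (at x within A)" for x A
      by (rule smooth_has_derivative[OF sm])
    have "\<phi> 0 = 0" "\<phi> e = 0" using out by (auto simp: e_def)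
    then have "(deriv \<phi> has_integral 0) {0..e}"
      using fundamental_theorem_of_calculus[of 0 e \<phi> "deriv \<phi>"] D e
      by (auto simp flip: has_real_derivative_iff_has_vector_derivative)
    moreover have I: "((\<lambda>x. deriv \<phi> x * H x) has_integral dist_of b H (deriv \<phi>)) {0..e}"
      if "H \<in> D_lc b" for H
    proof (rule has_integral_dist_of)
      show "deriv \<phi> x = 0" if "x \<notin> {0..e}" for x
        using that by (intro out') (auto simp: e_def)
    qed (use D_lc_subset_HK[OF that] sm smooth_deriv e in auto)
    ultimately have "((\<lambda>x. deriv \<phi> x * k + deriv \<phi> x * F x) has_integral 0 * k + dist_of b F (deriv \<phi>)) {0..e}"
      using F by (intro has_integral_add has_integral_mult_left)
    moreover have "((\<lambda>x. deriv \<phi> x * k + deriv \<phi> x * F x) has_integral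
        dist_of b (\<lambda>t\<in>Iv b. k + F t) (deriv \<phi>)) {0..e}"
      using Icc_subset_Iv[OF order.refl e(1)]
      by (intro has_integral_eq[OF _ I[OF D_lc_add_const[OF F b]]]) (auto simp: distrib_left subset_iff)
    ultimately have "0 * k + dist_of b F (deriv \<phi>) = dist_of b (\<lambda>t\<in>Iv b. k + F t) (deriv \<phi>)"
      by (rule has_integral_unique)
    then show ?thesis
      using True by (simp add: dist_deriv_def)
  qed (simp add: dist_deriv_def)
qed

text \<open>The value does not depend on the primitive chosen, as primitives are unique up to a constant.\<close>

lemma A_integral_eq:
  assumes F: "F \<in> D_lc b" and b: "0 < b" and x: "x \<in> Iv b"
  shows "A_integral b (dist_deriv b (dist_of b F)) x = F x - F 0"
proof -
  define G where "G = (SOME G. G \<in> D_lc b \<and> dist_deriv b (dist_of b F) = dist_deriv b (dist_of b G))"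
  have "G \<in> D_lc b \<and> dist_deriv b (dist_of b F) = dist_deriv b (dist_of b G)"
    unfolding G_def by (rule someI[of _ F]) (simp add: F)
  then have "F x - F 0 = G x - G 0"
    using dist_deriv_eq_imp_diff_const[OF F _ b _ x] by blast
  then show ?thesis
    unfolding A_integral_def Let_def G_def by (rule sym)
qed

definition has_D_lc_primitive :: "ereal \<Rightarrow> ((real \<Rightarrow> real) \<Rightarrow> real) \<Rightarrow> bool" where
  "has_D_lc_primitive b h \<longleftrightarrow> (\<exists>F\<in>D_lc b. h = dist_deriv b (dist_of b F))"

lemma A_D_has_D_lc_primitive: "h \<in> A_D b \<Longrightarrow> has_D_lc_primitive b h"
  by (auto simp: A_D_def has_D_lc_primitive_def)

text \<open>Level \<open>k\<close> is the derivative of order \<open>m - 1 - k\<close>, whose initial value is \<open>c (m - k)\<close>: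
  integration starts from the highest derivative.\<close>

primrec iterated_integral ::
  "ereal \<Rightarrow> nat \<Rightarrow> (nat \<Rightarrow> real) \<Rightarrow> ((real \<Rightarrow> real) \<Rightarrow> real) \<Rightarrow> nat \<Rightarrow> real \<Rightarrow> real" where
  "iterated_integral b m c h 0 = (\<lambda>t\<in>Iv b. c m + A_integral b h t)"
| "iterated_integral b m c h (Suc k) = primitive b (c (m - Suc k)) (iterated_integral b m c h k)"

definition cauchy_jet ::
  "ereal \<Rightarrow> nat \<Rightarrow> (nat \<Rightarrow> real) \<Rightarrow> ((real \<Rightarrow> real) \<Rightarrow> real) \<Rightarrow> nat \<Rightarrow> real \<Rightarrow> real" where
  "cauchy_jet b m c h i = iterated_integral b m c h (m - Suc i)"

lemma cauchy_jet_rec: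
  assumes "Suc i < m"
  shows "cauchy_jet b m c h i = primitive b (c (Suc i)) (cauchy_jet b m c h (Suc i))"
proof -
  have "m - Suc i = Suc (m - Suc (Suc i))" "m - Suc (m - Suc (Suc i)) = Suc i"
    using assms by linarith+
  then show ?thesis by (simp add: cauchy_jet_def)
qed

lemma iterated_integral_0_eq:
  assumes "F \<in> D_lc b" "0 < b"
  shows "iterated_integral b m c (dist_deriv b (dist_of b F)) 0 = (\<lambda>t\<in>Iv b. (c m - F 0) + F t)"
  using A_integral_eq[OF assms] by (auto intro!: restrict_ext)

lemma iterated_integral_in_D_lc:
  assumes "has_D_lc_primitive b h" "0 < b"
  shows "iterated_integral b m c h k \<in> D_lc b"
proof (induction k)
  case 0
  then show ?case
    using assms D_lc_add_const iterated_integral_0_eq unfolding has_D_lc_primitive_def by metis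
next
  case (Suc k)
  then show ?case
    using primitive_in_D_lc D_lc_subset_HK assms(2) by simp
qed

lemma cauchy_jet_in_D_lc:
  "has_D_lc_primitive b h \<Longrightarrow> 0 < b \<Longrightarrow> cauchy_jet b m c h i \<in> D_lc b"
  by (simp add: cauchy_jet_def iterated_integral_in_D_lc)

lemma cauchy_jet_last_deriv:
  assumes "has_D_lc_primitive b h" "0 < b"
  shows "dist_deriv b (dist_of b (cauchy_jet b m c h (m - 1))) = h"
proof -
  obtain F where F: "F \<in> D_lc b" "h = dist_deriv b (dist_of b F)"
    using assms(1) by (auto simp: has_D_lc_primitive_def)
  have "m - Suc (m - 1) = 0" by simp
  then show ?thesis
    unfolding cauchy_jet_def F(2)
    by (simp only: iterated_integral_0_eq[OF F(1) assms(2)] dist_deriv_add_const[OF F(1) assms(2)])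
qed

lemma cauchy_jet_at_0:
  assumes "has_D_lc_primitive b h" "0 < b" "i < m"
  shows "cauchy_jet b m c h i 0 = c (Suc i)"
proof (cases "Suc i < m")
  case True
  show ?thesis
    unfolding cauchy_jet_rec[OF True] primitive_def using Iv_zero[OF assms(2)] by simp
next
  case False
  then have m: "m - Suc i = 0" "m = Suc i" using assms(3) by linarith+
  obtain F where F: "F \<in> D_lc b" "h = dist_deriv b (dist_of b F)"
    using assms(1) by (auto simp: has_D_lc_primitive_def)
  show ?thesis
    unfolding cauchy_jet_def m(1) F(2) iterated_integral_0_eq[OF F(1) assms(2)]
    using Iv_zero[OF assms(2)] m(2) by simp
qed

lemma dist_deriv_n_0: "dist_deriv_n b 0 y = dist_of b y"
  by (simp add: dist_deriv_n_def)

lemma dist_deriv_n_Suc: "dist_deriv_n b (Suc i) y = dist_deriv b (dist_deriv_n b i y)"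
  by (simp add: dist_deriv_n_def)

lemma dist_of_cauchy_jet:
  assumes "has_D_lc_primitive b h" "0 < b" "i < m"
  shows "dist_of b (cauchy_jet b m c h i) = dist_deriv_n b i (cauchy_jet b m c h 0)"
  using assms(3)
proof (induction i)
  case (Suc i)
  have "dist_deriv_n b (Suc i) (cauchy_jet b m c h 0) = dist_deriv b (dist_of b (cauchy_jet b m c h i))"
    unfolding dist_deriv_n_Suc using Suc.IH Suc.prems by simp
  also have "\<dots> = dist_of b (cauchy_jet b m c h (Suc i))"
    unfolding cauchy_jet_rec[OF Suc.prems]
    by (intro dist_deriv_primitive D_lc_subset_HK cauchy_jet_in_D_lc assms(1,2))
  finally show ?case ..
qed (simp add: dist_deriv_n_0)

lemma lc_deriv_eqI:
  assumes "u \<in> D_lc b" "dist_of b u = dist_deriv_n b i y" "0 < b"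
  shows "lc_deriv b i y = u"
  unfolding lc_deriv_def
proof (rule the_equality)
  show "v = u" if "v \<in> D_lc b \<and> dist_of b v = dist_deriv_n b i y" for v
    using that assms by (intro dist_of_inj[of v b u]) simp_all
qed (simp add: assms)

lemma S_D_lc_deriv:
  assumes "y \<in> S_D b m" "i < m" "0 < b"
  shows "lc_deriv b i y \<in> D_lc b" "dist_of b (lc_deriv b i y) = dist_deriv_n b i y"
proof -
  obtain u where "u \<in> D_lc b" "dist_of b u = dist_deriv_n b i y"
    using assms by (auto simp: S_D_def)
  with lc_deriv_eqI[OF this assms(3)]
  show "lc_deriv b i y \<in> D_lc b" "dist_of b (lc_deriv b i y) = dist_deriv_n b i y"
    by auto
qed

lemma S_D_dist_deriv_n_Suc:
  assumes "y \<in> S_D b m" "i < m" "0 < b"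
  shows "dist_deriv_n b (Suc i) y = dist_deriv b (dist_of b (lc_deriv b i y))"
  using S_D_lc_deriv[OF assms] by (simp add: dist_deriv_n_Suc)

lemma S_D_has_D_lc_primitive:
  assumes "y \<in> S_D b m" "1 \<le> m" "0 < b"
  shows "has_D_lc_primitive b (dist_deriv_n b m y)"
  using S_D_dist_deriv_n_Suc[of y b m "m - 1"] S_D_lc_deriv(1)[of y b m "m - 1"] assms
  by (auto simp: has_D_lc_primitive_def)

text \<open>Every step of the construction is inverted by the distributional derivative.\<close>

lemma cauchy_jet_solves:
  assumes h: "has_D_lc_primitive b h" and b: "0 < b" and m: "1 \<le> m"
  shows "cauchy_jet b m c h 0 \<in> S_D b m"
    and "i < m \<Longrightarrow> lc_deriv b i (cauchy_jet b m c h 0) = cauchy_jet b m c h i"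
    and "dist_deriv_n b m (cauchy_jet b m c h 0) = h"
proof -
  show S: "cauchy_jet b m c h 0 \<in> S_D b m"
    using cauchy_jet_in_D_lc[OF h b] dist_of_cauchy_jet[OF h b] unfolding S_D_def by blast
  show eq: "lc_deriv b i (cauchy_jet b m c h 0) = cauchy_jet b m c h i" if "i < m" for i
    using that dist_of_cauchy_jet[OF h b] by (intro lc_deriv_eqI cauchy_jet_in_D_lc h b) auto
  show "dist_deriv_n b m (cauchy_jet b m c h 0) = h"
    using S_D_dist_deriv_n_Suc[OF S, of "m - 1"] cauchy_jet_last_deriv[OF h b] eq[of "m - 1"] m b by simp
qed

text \<open>Conversely, from order \<open>m - 1\<close> downwards, each derivative of \<open>y\<close> and the corresponding iterated
  integral have the same distributional derivative and the same value at \<open>0\<close>.\<close>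

lemma lc_deriv_eq_cauchy_jet:
  assumes y: "y \<in> S_D b m" and b: "0 < b" and "i < m"
  shows "lc_deriv b i y = cauchy_jet b m (\<lambda>j. lc_deriv b (j - 1) y 0) (dist_deriv_n b m y) i"
  using \<open>i < m\<close>
proof (induction "m - Suc i" arbitrary: i)
  case 0
  then have m: "m = Suc i" by linarith
  define u where "u = lc_deriv b i y"
  have u: "u \<in> D_lc b" "dist_deriv_n b m y = dist_deriv b (dist_of b u)"
    using S_D_lc_deriv(1)[OF y _ b] S_D_dist_deriv_n_Suc[OF y _ b, of i] by (auto simp: m u_def)
  then have "u \<in> extensional (Iv b)" by (simp add: D_lc_def HK_functions_def)
  then have "u = (\<lambda>t\<in>Iv b. (u 0 - u 0) + u t)" by (auto simp: extensional_restrict)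
  also have "\<dots> = iterated_integral b m (\<lambda>j. lc_deriv b (j - 1) y 0) (dist_deriv_n b m y) 0"
    unfolding u(2) iterated_integral_0_eq[OF u(1) b] by (simp add: m u_def)
  finally show ?case by (simp add: cauchy_jet_def u_def m)
next
  case (Suc k)
  then have i: "Suc i < m" "k = m - Suc (Suc i)" by linarith+
  define u where "u = lc_deriv b i y"
  define u' where "u' = lc_deriv b (Suc i) y"
  have u: "u \<in> D_lc b" "u' \<in> D_lc b" using S_D_lc_deriv(1)[OF y _ b] i by (auto simp: u_def u'_def)
  have P: "primitive b (u 0) u' \<in> D_lc b" by (intro primitive_in_D_lc D_lc_subset_HK u b)
  have "dist_deriv b (dist_of b u) = dist_of b u'"
    using S_D_dist_deriv_n_Suc[OF y _ b, of i] S_D_lc_deriv(2)[OF y i(1) b] i by (simp add: u_def u'_def)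
  also have "\<dots> = dist_deriv b (dist_of b (primitive b (u 0) u'))"
    by (simp add: dist_deriv_primitive D_lc_subset_HK u b)
  finally have eq: "u t - u 0 = primitive b (u 0) u' t - primitive b (u 0) u' 0" if "t \<in> Iv b" for t
    using dist_deriv_eq_imp_diff_const[OF u(1) P b] that by blast
  have "u = primitive b (u 0) u'"
  proof (rule extensionalityI[of _ "Iv b"])
    show "u t = primitive b (u 0) u' t" if "t \<in> Iv b" for t
      using eq[OF that] Iv_zero[OF b] by (simp add: primitive_def)
  qed (use u P in \<open>auto simp: D_lc_def HK_functions_def\<close>)
  then show ?case
    using Suc.hyps(1)[OF i(2,1)] by (simp add: cauchy_jet_rec[OF i(1)] u_def u'_def)
qed

lemma cauchy_jet_mono:
  assumes c: "\<And>j. j \<in> {1..m} \<Longrightarrow> c j \<le> c' j" and h: "A_le b h h'"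
    and prim: "has_D_lc_primitive b h" "has_D_lc_primitive b h'" and b: "0 < b"
    and i: "i < m" and t: "t \<in> Iv b"
  shows "cauchy_jet b m c h i t \<le> cauchy_jet b m c' h' i t"
proof -
  have "iterated_integral b m c h k t \<le> iterated_integral b m c' h' k t" if "k < m" "t \<in> Iv b" for k t
    using that
  proof (induction k arbitrary: t)
    case 0
    then show ?case using h c[of m] by (auto simp: A_le_def intro!: add_mono)
  next
    case (Suc k)
    have "integral {0..t} (iterated_integral b m c h k) \<le> integral {0..t} (iterated_integral b m c' h' k)"
    proof (rule integral_le)
      show "iterated_integral b m c h k s \<le> iterated_integral b m c' h' k s" if "s \<in> {0..t}" for s
        using that Suc Icc_subset_Iv[of 0 t b] by auto
    qed (use Suc.prems iterated_integral_in_D_lc[OF prim(1) b] iterated_integral_in_D_lc[OF prim(2) b]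
          in \<open>auto intro!: HK_integrable_Icc D_lc_subset_HK\<close>)
    moreover have "c (m - Suc k) \<le> c' (m - Suc k)" using Suc.prems by (intro c) auto
    ultimately show ?case using Suc.prems by (simp add: primitive_def)
  qed
  then show ?thesis using i t by (simp add: cauchy_jet_def)
qed

section \<open>Essential infima\<close>

text \<open>Among the countable subfamilies take one whose infimum has the smallest integral: enlarging it by
  one more member cannot lower the integral, so it does not lower the infimum on a set of positive
  measure. To make all integrals finite, values are compressed by \<open>arctan\<close> and an integrable
  positive weight \<open>h\<close> is used. The conclusion speaks of lower bounds \<open>r\<close> instead of an infimum,
  which need not exist in the reals at every point.\<close>

lemma ex_countable_essential_infimum:
  fixes F :: "('a \<Rightarrow> real) set"
  assumes "sigma_finite_measure M" and meas: "F \<subseteq> borel_measurable M" and "F \<noteq> {}"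
  obtains C where "C \<subseteq> F" "countable C" "C \<noteq> {}"
    "\<And>f. f \<in> F \<Longrightarrow> AE x in M. \<forall>r. (\<forall>g\<in>C. r \<le> g x) \<longrightarrow> r \<le> f x"
proof -
  interpret sigma_finite_measure M by fact
  obtain h :: "'a \<Rightarrow> ennreal" where h[measurable]: "h \<in> borel_measurable M"
    and hfin: "integral\<^sup>N M h \<noteq> \<infinity>"
    and hpos: "\<And>x. x \<in> space M \<Longrightarrow> 0 < h x \<and> h x < \<infinity>"
    using Ex_finite_integrable_function by auto
  define K :: "('a \<Rightarrow> real) \<Rightarrow> 'a \<Rightarrow> ennreal" where "K f x = ennreal (arctan (f x) + pi / 2)" for f x
  have K_le: "K f x \<le> ennreal pi" for f x
    unfolding K_def using arctan_ubound[of "f x"] by (intro ennreal_leI) auto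
  have K_meas[measurable]: "f \<in> F \<Longrightarrow> K f \<in> borel_measurable M" for f
    using meas unfolding K_def by (auto intro!: measurable_compose[OF _ measurable_ennreal]
        borel_measurable_add borel_measurable_arctan)
  define J where "J C x = (INF g\<in>C. K g x)" for C x
  have J_meas[measurable]: "J C \<in> borel_measurable M" if "C \<subseteq> F" "countable C" for C
    unfolding J_def using that by (intro borel_measurable_INF) auto
  define W where "W C = (\<integral>\<^sup>+x. h x * J C x \<partial>M)" for C
  define CC where "CC = {C. C \<subseteq> F \<and> countable C \<and> C \<noteq> {}}"
  have "CC \<noteq> {}" using \<open>F \<noteq> {}\<close> by (auto simp: CC_def intro: exI[of _ "{_}"])
  \<comment> \<open>The least integral is attained at the union of a minimising sequence of countable families.\<close>
  then obtain w where w: "\<And>n. w n \<in> W ` CC" "w \<longlonglongrightarrow> Inf (W ` CC)"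
    using Inf_as_limit[of "W ` CC"] by auto
  then have "\<forall>n. \<exists>C\<in>CC. w n = W C" by blast
  then obtain Cs where Cs: "\<And>n. Cs n \<in> CC" "\<And>n. w n = W (Cs n)" by metis
  define C where "C = (\<Union>n. Cs n)"
  have C: "C \<in> CC"
    using Cs(1) unfolding CC_def C_def by auto
  have anti: "J C' x \<le> J C x" if "C \<subseteq> C'" for C C' x
    unfolding J_def using that by (rule INF_superset_mono) auto
  have Wmin: "W C \<le> W C'" if "C' \<in> CC" for C'
  proof -
    have "W C \<le> w n" for n
      unfolding Cs W_def by (intro nn_integral_mono mult_left_mono anti) (auto simp: C_def)
    then have "W C \<le> Inf (W ` CC)" using w(2) by (intro LIMSEQ_le_const) auto
    also have "\<dots> \<le> W C'" using that by (simp add: INF_lower)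
    finally show ?thesis .
  qed
  have Wfin: "W C \<noteq> \<infinity>"
  proof -
    obtain g where "g \<in> C" using C by (auto simp: CC_def)
    then have "W C \<le> (\<integral>\<^sup>+x. h x * ennreal pi \<partial>M)"
      unfolding W_def J_def
      by (intro nn_integral_mono mult_left_mono) (auto intro: INF_lower2 K_le)
    also have "\<dots> = integral\<^sup>N M h * ennreal pi" by (simp add: nn_integral_multc)
    also have "\<dots> < \<infinity>" using hfin by (simp add: ennreal_mult_less_top less_top)
    finally show ?thesis by simp
  qed
  have "AE x in M. \<forall>r. (\<forall>g\<in>C. r \<le> g x) \<longrightarrow> r \<le> f x" if f: "f \<in> F" for f
  proof -
    have fC: "insert f C \<in> CC" using C f by (auto simp: CC_def)
    have [measurable]: "J C \<in> borel_measurable M" "J (insert f C) \<in> borel_measurable M"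
      using C fC by (auto simp: CC_def)
    have "AE x in M. h x * J C x \<le> h x * J (insert f C) x"
    proof (rule AE_mp[OF _ AE_I2])
      have "(\<integral>\<^sup>+x. h x * J C x - h x * J (insert f C) x \<partial>M) = W C - W (insert f C)"
        unfolding W_def
      proof (rule nn_integral_diff)
        show "(\<integral>\<^sup>+x. h x * J (insert f C) x \<partial>M) \<noteq> \<infinity>"
        proof -
          have "W (insert f C) \<le> W C"
            unfolding W_def by (intro nn_integral_mono mult_left_mono anti) auto
          then show ?thesis using Wfin unfolding W_def by (auto simp: top_unique)
        qed
        show "AE x in M. h x * J (insert f C) x \<le> h x * J C x"
          by (intro AE_I2 mult_left_mono anti) auto
      qed auto
      also have "\<dots> = 0" using Wmin[OF fC] Wfin by (simp add: diff_eq_0_iff_ennreal flip: less_top)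
      finally show "AE x in M. h x * J C x - h x * J (insert f C) x = 0"
        by (simp add: nn_integral_0_iff_AE)
      fix x assume x: "x \<in> space M"
      have "J C x \<noteq> \<infinity>"
      proof -
        obtain g where "g \<in> C" using C by (auto simp: CC_def)
        then have "J C x \<le> ennreal pi" unfolding J_def by (auto intro: INF_lower2 K_le)
        then show ?thesis by (auto simp: top_unique)
      qed
      then have "h x * J C x < \<infinity>" using hpos[OF x] by (simp add: ennreal_mult_less_top less_top)
      then show "h x * J C x - h x * J (insert f C) x = 0 \<longrightarrow> h x * J C x \<le> h x * J (insert f C) x"
        by (auto simp: diff_eq_0_iff_ennreal)
    qed
    then show ?thesis
    proof (rule AE_mp[OF _ AE_I2], intro impI allI)
      fix x r assume x: "x \<in> space M" and le: "h x * J C x \<le> h x * J (insert f C) x"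
        and r: "\<forall>g\<in>C. r \<le> g x"
      have "J C x \<le> J (insert f C) x"
        using le hpos[OF x] ennreal_mult_le_mult_iff[of "h x"] by (auto simp: less_top)
      also have "\<dots> \<le> K f x" unfolding J_def by (auto intro: INF_lower)
      finally have "J C x \<le> K f x" .
      moreover have "ennreal (arctan r + pi / 2) \<le> J C x"
        unfolding J_def K_def using r by (intro INF_greatest ennreal_leI) (auto simp: arctan_le_iff)
      ultimately have "ennreal (arctan r + pi / 2) \<le> ennreal (arctan (f x) + pi / 2)"
        unfolding K_def by order
      then have "arctan r \<le> arctan (f x)"
        using arctan_lbound[of "f x"] by (simp add: ennreal_le_iff)
      then show "r \<le> f x" by (simp add: arctan_le_iff)
    qed
  qed
  with C show ?thesis using that unfolding CC_def by blast
qed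

lemma sigma_finite_lebesgue: "sigma_finite_measure (lebesgue :: 'a::euclidean_space measure)"
proof
  show "\<exists>A::'a set set. countable A \<and> A \<subseteq> sets lebesgue \<and> \<Union>A = space lebesgue \<and>
      (\<forall>a\<in>A. emeasure lebesgue a \<noteq> \<infinity>)"
  proof (intro exI[of _ "range (\<lambda>n::nat. cball (0::'a) n)"] conjI ballI)
    have "\<exists>n::nat. norm x \<le> n" for x :: 'a by (rule real_arch_simple)
    then show "(\<Union>n::nat. cball (0::'a) n) = space lebesgue" by auto
    show "emeasure lebesgue a \<noteq> \<infinity>" if "a \<in> range (\<lambda>n::nat. cball (0::'a) n)" for a
      using that by (metis fmeasurableD2 lmeasurable_cball imageE infinity_ennreal_def)
  qed auto
qed

lemma sets_lebesgue_Iv: "Iv b \<in> sets lebesgue"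
proof -
  have "Iv b \<in> sets borel" unfolding Iv_def by measurable
  then show ?thesis by simp
qed

lemma AE_lebesgue_on_Iv: "(AE t in lebesgue_on (Iv b). P t) \<longleftrightarrow> (AE t in lebesgue. t \<in> Iv b \<longrightarrow> P t)"
  using sets_lebesgue_Iv[of b] by (intro AE_restrict_space_iff) simp

text \<open>Integrability on compact intervals gives measurability there, and countably many of them cover
  \<open>[0,b)\<close>.\<close>

lemma HK_functions_measurable:
  assumes "H \<in> HK_functions b"
  shows "H \<in> borel_measurable (lebesgue_on (Iv b))"
proof (rule measurable_piecewise_restrict[where C = "(\<lambda>q. {0..q}) ` (Iv b \<inter> \<rat>)"])
  show "countable ((\<lambda>q. {0..q}) ` (Iv b \<inter> \<rat>))"
    by (intro countable_image countable_Int2 countable_rat)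
  show "space (lebesgue_on (Iv b)) \<subseteq> \<Union> ((\<lambda>q. {0..q}) ` (Iv b \<inter> \<rat>))"
  proof
    fix t assume "t \<in> space (lebesgue_on (Iv b))"
    then have t: "t \<in> Iv b" by (simp add: space_restrict_space)
    then obtain d where d: "d \<in> Iv b" "t < d" using Iv_exists_greater by blast
    then obtain q where "q \<in> \<rat>" "t < q" "q < d" using Rats_dense_in_real by blast
    then show "t \<in> \<Union> ((\<lambda>q. {0..q}) ` (Iv b \<inter> \<rat>))"
      using t Icc_subset_Iv[OF order.refl d(1)] Iv_nonneg[OF t] by (intro UN_I[of q]) auto
  qed
  fix \<Omega> assume "\<Omega> \<in> (\<lambda>q. {0..q}) ` (Iv b \<inter> \<rat>)"
  then obtain q where q: "\<Omega> = {0..q}" "q \<in> Iv b" by blast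
  then have sub: "\<Omega> \<subseteq> Iv b" using Icc_subset_Iv by blast
  show "\<Omega> \<inter> space (lebesgue_on (Iv b)) \<in> sets (lebesgue_on (Iv b))"
    using sub sets_lebesgue_Iv q(1) by (auto simp: sets_restrict_space space_restrict_space
        intro!: image_eqI[of _ _ \<Omega>])
  have "H integrable_on {0..q}" using assms q(2) by (intro HK_integrable_Icc) auto
  then have "H \<in> borel_measurable (lebesgue_on \<Omega>)" unfolding q(1) by (rule integrable_imp_measurable)
  then show "H \<in> borel_measurable (restrict_space (lebesgue_on (Iv b)) \<Omega>)"
    using sub sets_lebesgue_Iv[of b] q(1) by (simp add: restrict_restrict_space Int_absorb1)
qed

text \<open>The difference \<open>v - lo\<close> is nonnegative, measurable and bounded by the integrable function
  \<open>hi - lo\<close>; this is where the bounds turn measurability into integrability.\<close>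

lemma HK_functions_between:
  assumes lo: "lo \<in> HK_functions b" and hi: "hi \<in> HK_functions b"
    and v: "v \<in> borel_measurable (lebesgue_on (Iv b))" "v \<in> extensional (Iv b)"
    and bounds: "\<And>t. t \<in> Iv b \<Longrightarrow> lo t \<le> v t \<and> v t \<le> hi t"
  shows "v \<in> HK_functions b"
proof -
  have "v integrable_on {a..d}" if ad: "{a..d} \<subseteq> Iv b" for a d
  proof -
    have i: "lo integrable_on {a..d}" "hi integrable_on {a..d}"
      using lo hi ad by (auto simp: HK_functions_def)
    have "(\<lambda>t. v t - lo t) integrable_on {a..d}"
    proof (rule measurable_bounded_by_integrable_imp_integrable)
      show "(\<lambda>t. v t - lo t) \<in> borel_measurable (lebesgue_on {a..d})"
        using v(1) HK_functions_measurable[OF lo] ad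
        by (intro borel_measurable_diff) (auto elim: measurable_restrict_mono)
      show "(\<lambda>t. hi t - lo t) integrable_on {a..d}"
        by (intro integrable_diff i)
    qed (use ad bounds in \<open>auto simp: subset_iff\<close>)
    then have "(\<lambda>t. (v t - lo t) + lo t) integrable_on {a..d}"
      by (intro integrable_add i)
    then show ?thesis by simp
  qed
  then show ?thesis using v(2) by (simp add: HK_functions_def)
qed

text \<open>The infimum over a suitable countable subfamily is both pointwise between the bounds, hence
  integrable, and an essential infimum of the whole family.\<close>

lemma ex_HK_infimum:
  assumes lo: "lo \<in> HK_functions b" and hi: "hi \<in> HK_functions b"
    and A: "A \<subseteq> HK_functions b" "A \<noteq> {}"
    and bounds: "\<And>u t. u \<in> A \<Longrightarrow> t \<in> Iv b \<Longrightarrow> lo t \<le> u t \<and> u t \<le> hi t"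
  shows "\<exists>v\<in>HK_functions b. (\<forall>t\<in>Iv b. lo t \<le> v t \<and> v t \<le> hi t) \<and>
      (\<forall>u\<in>A. AE t in lebesgue. t \<in> Iv b \<longrightarrow> v t \<le> u t) \<and>
      (\<forall>l. (\<forall>u\<in>A. AE t in lebesgue. t \<in> Iv b \<longrightarrow> l t \<le> u t) \<longrightarrow>
        (AE t in lebesgue. t \<in> Iv b \<longrightarrow> l t \<le> v t))"
proof -
  have "sigma_finite_measure (lebesgue_on (Iv b))"
    by (intro sigma_finite_measure_restrict_space sigma_finite_lebesgue sets_lebesgue_Iv)
  then obtain C where C: "C \<subseteq> A" "countable C" "C \<noteq> {}"
    and ess: "\<And>u. u \<in> A \<Longrightarrow> AE t in lebesgue_on (Iv b). \<forall>r. (\<forall>g\<in>C. r \<le> g t) \<longrightarrow> r \<le> u t"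
    using ex_countable_essential_infimum[of "lebesgue_on (Iv b)" A] A HK_functions_measurable by blast
  define v where "v = (\<lambda>t\<in>Iv b. INF g\<in>C. g t)"
  have v_le: "v t \<le> g t" if "g \<in> C" "t \<in> Iv b" for g t
    using that bounds C(1) by (auto simp: v_def intro!: cINF_lower bdd_belowI2[of _ "lo t"])
  have le_v: "r \<le> v t" if "\<forall>g\<in>C. r \<le> g t" "t \<in> Iv b" for r t
    using that C(3) by (auto simp: v_def intro!: cINF_greatest)
  have between: "lo t \<le> v t \<and> v t \<le> hi t" if "t \<in> Iv b" for t
  proof -
    obtain g where "g \<in> C" using C(3) by blast
    then show ?thesis
      using v_le[of g t] le_v[of "lo t" t] bounds C(1) that by (meson order_trans subsetD)
  qed
  have v: "v \<in> HK_functions b"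
  proof (rule HK_functions_between[OF lo hi _ _ between])
    have "(\<lambda>t. INF g\<in>C. g t) \<in> borel_measurable (lebesgue_on (Iv b))"
      using C A HK_functions_measurable by (intro borel_measurable_cINF_real) auto
    then show "v \<in> borel_measurable (lebesgue_on (Iv b))"
      by (rule measurable_cong[THEN iffD1, rotated]) (simp add: v_def)
  qed (unfold v_def, rule restrict_extensional)
  have "AE t in lebesgue. t \<in> Iv b \<longrightarrow> v t \<le> u t" if "u \<in> A" for u
    using ess[OF that] unfolding AE_lebesgue_on_Iv
    by (rule eventually_mono) (auto intro: v_le)
  moreover have "AE t in lebesgue. t \<in> Iv b \<longrightarrow> l t \<le> v t"
    if "\<forall>u\<in>A. AE t in lebesgue. t \<in> Iv b \<longrightarrow> l t \<le> u t" for l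
  proof -
    have "AE t in lebesgue. \<forall>g\<in>C. t \<in> Iv b \<longrightarrow> l t \<le> g t"
      using that C by (subst AE_ball_countable) auto
    then show ?thesis by (rule eventually_mono) (auto intro: le_v)
  qed
  ultimately show ?thesis using v between by blast
qed

section \<open>Fixed points of increasing maps\<close>

text \<open>The relation is only a preorder, as it is going to be an inequality almost everywhere; so the
  fixed point is one up to the induced equivalence.\<close>

lemma preorder_Knaster_Tarski_least:
  assumes trans: "transp_on X le" and T: "T \<in> X \<rightarrow> X" and mono: "monotone_on X le le T"
    and top: "hi \<in> X" "\<And>x. x \<in> X \<Longrightarrow> le x hi"
    and inf: "\<And>A. A \<subseteq> X \<Longrightarrow> A \<noteq> {} \<Longrightarrow>
      \<exists>i\<in>X. (\<forall>a\<in>A. le i a) \<and> (\<forall>l\<in>X. (\<forall>a\<in>A. le l a) \<longrightarrow> le l i)"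
  shows "\<exists>x\<in>X. le (T x) x \<and> le x (T x) \<and> (\<forall>z\<in>X. le (T z) z \<longrightarrow> le x z)"
proof -
  define A where "A = {z\<in>X. le (T z) z}"
  have TX: "T x \<in> X" if "x \<in> X" for x using T that by blast
  have "hi \<in> A" using top TX by (auto simp: A_def)
  then obtain x where x: "x \<in> X" "\<And>a. a \<in> A \<Longrightarrow> le x a" "\<And>l. l \<in> X \<Longrightarrow> \<forall>a\<in>A. le l a \<Longrightarrow> le l x"
    using inf[of A] unfolding A_def by blast
  have "le (T x) a" if "a \<in> A" for a
  proof (rule transp_onD[OF trans])
    show "le (T x) (T a)" "le (T a) a"
      using that x(1,2) by (auto simp: A_def intro: monotone_onD[OF mono])
  qed (use that x(1) TX in \<open>auto simp: A_def\<close>)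
  then have "le (T x) x" using x TX by blast
  moreover from this have "T x \<in> A"
    using monotone_onD[OF mono, of "T x" x] TX x(1) by (auto simp: A_def)
  then have "le x (T x)" by (rule x(2))
  ultimately show ?thesis using x(1,2) by (auto simp: A_def)
qed

text \<open>Infima of nonempty sets provide suprema, as infima of upper bounds, and the dual order satisfies
  the assumptions for a least fixed point.\<close>

lemma preorder_Knaster_Tarski_greatest:
  assumes trans: "transp_on X le" and T: "T \<in> X \<rightarrow> X" and mono: "monotone_on X le le T"
    and top: "hi \<in> X" "\<And>x. x \<in> X \<Longrightarrow> le x hi"
    and bot: "lo \<in> X" "\<And>x. x \<in> X \<Longrightarrow> le lo x"
    and inf: "\<And>A. A \<subseteq> X \<Longrightarrow> A \<noteq> {} \<Longrightarrow>
      \<exists>i\<in>X. (\<forall>a\<in>A. le i a) \<and> (\<forall>l\<in>X. (\<forall>a\<in>A. le l a) \<longrightarrow> le l i)"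
  shows "\<exists>x\<in>X. le x (T x) \<and> le (T x) x \<and> (\<forall>z\<in>X. le z (T z) \<longrightarrow> le z x)"
proof (rule preorder_Knaster_Tarski_least[where le = "\<lambda>x y. le y x"])
  show "transp_on X (\<lambda>x y. le y x)"
    using trans by (auto intro!: transp_onI dest: transp_onD)
  show "monotone_on X (\<lambda>x y. le y x) (\<lambda>x y. le y x) T"
    using mono by (auto intro!: monotone_onI dest: monotone_onD)
  show "\<exists>i\<in>X. (\<forall>a\<in>A. le a i) \<and> (\<forall>l\<in>X. (\<forall>a\<in>A. le a l) \<longrightarrow> le i l)" if "A \<subseteq> X" for A
  proof -
    define U where "U = {l\<in>X. \<forall>a\<in>A. le a l}"
    have "hi \<in> U" using top that by (auto simp: U_def)
    then obtain i where "i \<in> X" "\<forall>u\<in>U. le i u" "\<And>l. l \<in> X \<Longrightarrow> \<forall>u\<in>U. le l u \<Longrightarrow> le l i"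
      using inf[of U] unfolding U_def by blast
    then show ?thesis using that unfolding U_def by blast
  qed
qed (fact T bot)+

section \<open>Classes of almost everywhere equal functions\<close>

lemma equiv_HK_rel: "equiv (HK_functions b) (HK_rel b)"
proof (rule equivI)
  show "HK_rel b \<subseteq> HK_functions b \<times> HK_functions b"
    by (auto simp: HK_rel_def)
  show "refl_on (HK_functions b) (HK_rel b)"
    by (auto simp: HK_rel_def intro!: refl_onI)
  show "sym (HK_rel b)"
    by (auto simp: HK_rel_def intro!: symI elim: eventually_mono)
  show "trans (HK_rel b)"
    unfolding HK_rel_def by (rule transI) (auto elim: eventually_elim2)
qed

lemma HK_class_in_HK_loc: "H \<in> HK_functions b \<Longrightarrow> HK_class b H \<in> HK_loc b"
  by (simp add: HK_class_def HK_loc_def quotientI)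

lemma HK_class_eqI:
  "H \<in> HK_functions b \<Longrightarrow> K \<in> HK_functions b \<Longrightarrow> AE t in lebesgue. t \<in> Iv b \<longrightarrow> H t = K t \<Longrightarrow>
    HK_class b H = HK_class b K"
  unfolding HK_class_def by (rule equiv_class_eq[OF equiv_HK_rel]) (simp add: HK_rel_def)

lemma HK_le_classI:
  "H \<in> HK_functions b \<Longrightarrow> K \<in> HK_functions b \<Longrightarrow> AE t in lebesgue. t \<in> Iv b \<longrightarrow> H t \<le> K t \<Longrightarrow>
    HK_le b (HK_class b H) (HK_class b K)"
  using equiv_class_self[OF equiv_HK_rel, of H b] equiv_class_self[OF equiv_HK_rel, of K b]
  by (auto simp: HK_le_def HK_class_def)

text \<open>Turns representatives into the argument type of the right-hand side, so that estimates can be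
  made with functions.\<close>

definition HK_tuple :: "ereal \<Rightarrow> nat \<Rightarrow> (nat \<Rightarrow> real \<Rightarrow> real) \<Rightarrow> nat \<Rightarrow> (real \<Rightarrow> real) set" where
  "HK_tuple b m x = (\<lambda>i\<in>{..<m}. HK_class b (x i))"

lemma jet_eq_HK_tuple: "jet b m y = HK_tuple b m (\<lambda>i. lc_deriv b i y)"
  by (simp add: jet_def HK_tuple_def)

lemma HK_tuple_in_HK_loc_prod:
  "(\<And>i. i < m \<Longrightarrow> x i \<in> HK_functions b) \<Longrightarrow> HK_tuple b m x \<in> HK_loc_prod b m"
  by (auto simp: HK_tuple_def HK_loc_prod_def HK_class_in_HK_loc)

lemma jet_in_HK_loc_prod: "y \<in> S_D b m \<Longrightarrow> 0 < b \<Longrightarrow> jet b m y \<in> HK_loc_prod b m"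
  unfolding jet_eq_HK_tuple by (intro HK_tuple_in_HK_loc_prod D_lc_subset_HK S_D_lc_deriv)

section \<open>Extremal solutions\<close>

lemma A_le_trans: "A_le b f g \<Longrightarrow> A_le b g h \<Longrightarrow> A_le b f h"
  unfolding A_le_def by (meson order_trans)

lemma S_le_trans: "S_le b m x y \<Longrightarrow> S_le b m y z \<Longrightarrow> S_le b m x z"
  unfolding S_le_def by (meson order_trans)

text \<open>Comparison with all super- (sub-) solutions of the interval, not only with solutions, is what
  makes the extremal solutions monotone in the data.\<close>

lemma ex_extremal_solutions:
  assumes b: "0 < b" and m: "1 \<le> m" and g: "increasing_rhs b m g"
    and sub: "subsolution b m g c ylo" and super: "supersolution b m g c yhi"
    and le: "S_le b m ylo yhi"
  shows "\<exists>y\<in>S_interval b m ylo yhi. solution b m g c y \<and>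
           (\<forall>z\<in>S_interval b m ylo yhi. supersolution b m g c z \<longrightarrow> S_le b m y z)" (is ?least)
    and "\<exists>y\<in>S_interval b m ylo yhi. solution b m g c y \<and>
           (\<forall>z\<in>S_interval b m ylo yhi. subsolution b m g c z \<longrightarrow> S_le b m z y)" (is ?greatest)
proof -
  define lo where "lo i = lc_deriv b i ylo" for i
  define hi where "hi i = lc_deriv b i yhi" for i
  \<comment> \<open>The preorder \<open>ale\<close> ignores null sets, but \<open>T\<close> respects the bounds at every point; required
    in that form in \<open>X\<close>, they make infima of representatives finite everywhere.\<close>
  define X where "X = {x. \<forall>i<m. x i \<in> HK_functions b \<and> (\<forall>t\<in>Iv b. lo i t \<le> x i t \<and> x i t \<le> hi i t)}"
  define ale :: "(nat \<Rightarrow> real \<Rightarrow> real) \<Rightarrow> (nat \<Rightarrow> real \<Rightarrow> real) \<Rightarrow> bool"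
    where "ale x z \<longleftrightarrow> (\<forall>i<m. AE t in lebesgue. t \<in> Iv b \<longrightarrow> x i t \<le> z i t)" for x z
  define T where "T x = cauchy_jet b m c (g (HK_tuple b m x))" for x
  have ylo: "ylo \<in> S_D b m" and yhi: "yhi \<in> S_D b m"
    using sub super by (auto simp: subsolution_def supersolution_def)
  have X_HK: "x i \<in> HK_functions b" if "x \<in> X" "i < m" for x i
    using that by (simp add: X_def)
  have X_tuple: "HK_tuple b m x \<in> HK_loc_prod b m" if "x \<in> X" for x
    using X_HK that by (intro HK_tuple_in_HK_loc_prod) auto
  have g_prim: "has_D_lc_primitive b (g p)" if "p \<in> HK_loc_prod b m" for p
    using g that by (intro A_D_has_D_lc_primitive) (auto simp: increasing_rhs_def)
  have g_mono: "A_le b (g (HK_tuple b m x)) (g (HK_tuple b m z))" if "x \<in> X" "z \<in> X" "ale x z" for x z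
  proof -
    have "HK_prod_le b m (HK_tuple b m x) (HK_tuple b m z)"
      using that X_HK by (auto simp: HK_prod_le_def HK_tuple_def ale_def intro!: HK_le_classI)
    then show ?thesis
      using g X_tuple that by (auto simp: increasing_rhs_def monotone_on_def)
  qed
  have interval_X: "(\<lambda>i. lc_deriv b i z) \<in> X" if "z \<in> S_interval b m ylo yhi" for z
    using that S_D_lc_deriv(1)[OF _ _ b] D_lc_subset_HK
    by (auto simp: X_def S_interval_def S_le_def lo_def hi_def)
  have lo_in: "ylo \<in> S_interval b m ylo yhi" and hi_in: "yhi \<in> S_interval b m ylo yhi"
    using ylo yhi le by (auto simp: S_interval_def S_le_def)
  have loX: "lo \<in> X" and hiX: "hi \<in> X"
    using interval_X[OF lo_in] interval_X[OF hi_in] by (simp_all add: lo_def[abs_def] hi_def[abs_def])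
  have lo_le: "ale lo x" and le_hi: "ale x hi" if "x \<in> X" for x
    using that by (auto simp: X_def ale_def)
  have T_D_lc: "T x i \<in> D_lc b" if "x \<in> X" for x i
    unfolding T_def using that by (intro cauchy_jet_in_D_lc g_prim X_tuple b)
  have super_T: "T x i t \<le> lc_deriv b i z t"
    if z: "z \<in> S_D b m" "A_le b (g (HK_tuple b m x)) (dist_deriv_n b m z)"
      "\<forall>i\<in>{1..m}. c i \<le> lc_deriv b (i - 1) z 0" and x: "x \<in> X" "i < m" "t \<in> Iv b" for x z i t
    unfolding T_def lc_deriv_eq_cauchy_jet[OF z(1) b x(2)] using z x m
    by (intro cauchy_jet_mono g_prim X_tuple S_D_has_D_lc_primitive b) auto
  have sub_T: "lc_deriv b i z t \<le> T x i t"
    if z: "z \<in> S_D b m" "A_le b (dist_deriv_n b m z) (g (HK_tuple b m x))"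
      "\<forall>i\<in>{1..m}. lc_deriv b (i - 1) z 0 \<le> c i" and x: "x \<in> X" "i < m" "t \<in> Iv b" for x z i t
    unfolding T_def lc_deriv_eq_cauchy_jet[OF z(1) b x(2)] using z x m
    by (intro cauchy_jet_mono g_prim X_tuple S_D_has_D_lc_primitive b) auto
  have lo_T: "lo i t \<le> T x i t" and T_hi: "T x i t \<le> hi i t" if "x \<in> X" "i < m" "t \<in> Iv b" for x i t
  proof -
    have "A_le b (dist_deriv_n b m ylo) (g (HK_tuple b m x))"
      using sub g_mono[OF loX that(1) lo_le[OF that(1)]] A_le_trans
      unfolding subsolution_def jet_eq_HK_tuple lo_def[abs_def, symmetric] by blast
    then show "lo i t \<le> T x i t"
      unfolding lo_def using sub that by (intro sub_T) (auto simp: subsolution_def)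
    have "A_le b (g (HK_tuple b m x)) (dist_deriv_n b m yhi)"
      using super g_mono[OF that(1) hiX le_hi[OF that(1)]] A_le_trans
      unfolding supersolution_def jet_eq_HK_tuple hi_def[abs_def, symmetric] by blast
    then show "T x i t \<le> hi i t"
      unfolding hi_def using super that by (intro super_T) (auto simp: supersolution_def)
  qed
  have T_X: "T x \<in> X" if "x \<in> X" for x
    using that lo_T T_hi T_D_lc D_lc_subset_HK unfolding X_def by blast
  have T_mono: "ale (T x) (T z)" if "x \<in> X" "z \<in> X" "ale x z" for x z
    unfolding ale_def T_def using that b
    by (intro allI impI AE_I2 cauchy_jet_mono g_mono g_prim X_tuple) auto
  have ale_trans: "ale x w" if "ale x z" "ale z w" for x z w
    unfolding ale_def
  proof (intro allI impI)
    fix i assume "i < m"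
    with that have "AE t in lebesgue. t \<in> Iv b \<longrightarrow> x i t \<le> z i t"
      "AE t in lebesgue. t \<in> Iv b \<longrightarrow> z i t \<le> w i t"
      by (auto simp: ale_def)
    then show "AE t in lebesgue. t \<in> Iv b \<longrightarrow> x i t \<le> w i t"
      by eventually_elim auto
  qed
  have transp: "transp_on X ale" and mono: "monotone_on X ale ale T" and T_funcset: "T \<in> X \<rightarrow> X"
    using ale_trans T_mono T_X by (blast intro: transp_onI monotone_onI)+
  have ale_inf: "\<exists>v\<in>X. (\<forall>a\<in>A. ale v a) \<and> (\<forall>l\<in>X. (\<forall>a\<in>A. ale l a) \<longrightarrow> ale l v)"
    if A: "A \<subseteq> X" "A \<noteq> {}" for A
  proof -
    define glb where "glb i v \<longleftrightarrow> (\<forall>t\<in>Iv b. lo i t \<le> v t \<and> v t \<le> hi i t) \<and>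
      (\<forall>u\<in>(\<lambda>x. x i) ` A. AE t in lebesgue. t \<in> Iv b \<longrightarrow> v t \<le> u t) \<and>
      (\<forall>l. (\<forall>u\<in>(\<lambda>x. x i) ` A. AE t in lebesgue. t \<in> Iv b \<longrightarrow> l t \<le> u t) \<longrightarrow>
        (AE t in lebesgue. t \<in> Iv b \<longrightarrow> l t \<le> v t))" for i v
    have "\<exists>v\<in>HK_functions b. glb i v" if "i < m" for i
      unfolding glb_def
    proof (rule ex_HK_infimum)
      show "lo i \<in> HK_functions b" "hi i \<in> HK_functions b"
        using X_HK[OF loX that] X_HK[OF hiX that] .
      show "(\<lambda>x. x i) ` A \<subseteq> HK_functions b" using A(1) X_HK[OF _ that] by blast
      show "(\<lambda>x. x i) ` A \<noteq> {}" using A(2) by simp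
      show "lo i t \<le> u t \<and> u t \<le> hi i t" if "u \<in> (\<lambda>x. x i) ` A" "t \<in> Iv b" for u t
        using that A(1) \<open>i < m\<close> unfolding X_def by blast
    qed
    then have "\<exists>v. \<forall>i<m. v i \<in> HK_functions b \<and> glb i (v i)"
      by (intro choice) blast
    then obtain v where v: "\<And>i. i < m \<Longrightarrow> v i \<in> HK_functions b" "\<And>i. i < m \<Longrightarrow> glb i (v i)"
      by blast
    have "v \<in> X" using v by (simp add: X_def glb_def)
    moreover have "ale v a" if "a \<in> A" for a
      using v(2) that unfolding ale_def glb_def by blast
    moreover have "ale l v" if "\<forall>a\<in>A. ale l a" for l
      using v(2) that unfolding ale_def glb_def by blast
    ultimately show ?thesis by blast
  qed
  \<comment> \<open>A fixed point \<open>x\<close> up to null sets has the same classes as \<open>T x\<close>, whose components are the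
    derivatives of \<open>T x 0\<close>.\<close>
  have fixed_point: "T x 0 \<in> S_interval b m ylo yhi \<and> solution b m g c (T x 0) \<and>
      (\<forall>i<m. lc_deriv b i (T x 0) = T x i)" if x: "x \<in> X" "ale (T x) x" "ale x (T x)" for x
  proof -
    have prim: "has_D_lc_primitive b (g (HK_tuple b m x))" using x(1) by (intro g_prim X_tuple)
    note solves = cauchy_jet_solves[where c = c, OF prim b m, folded T_def]
    have "HK_class b (T x i) = HK_class b (x i)" if "i < m" for i
    proof (rule HK_class_eqI)
      have "AE t in lebesgue. t \<in> Iv b \<longrightarrow> T x i t \<le> x i t"
        "AE t in lebesgue. t \<in> Iv b \<longrightarrow> x i t \<le> T x i t"
        using x that by (auto simp: ale_def)
      then show "AE t in lebesgue. t \<in> Iv b \<longrightarrow> T x i t = x i t"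
        by eventually_elim auto
    qed (use X_HK T_X x that in auto)
    then have "jet b m (T x 0) = HK_tuple b m x"
      by (auto simp: jet_eq_HK_tuple HK_tuple_def solves(2) intro!: restrict_ext)
    then have "solution b m g c (T x 0)"
      unfolding solution_def
      using solves cauchy_jet_at_0[where m = m and c = c, OF prim b, folded T_def] by auto
    moreover have "T x 0 \<in> S_interval b m ylo yhi"
      using solves(1,2) lo_T[OF x(1)] T_hi[OF x(1)]
      by (auto simp: S_interval_def S_le_def lo_def[symmetric] hi_def[symmetric])
    ultimately show ?thesis using solves(2) by blast
  qed
  have S_leI: "S_le b m y z"
    if "y \<in> S_D b m" "z \<in> S_D b m" "ale (\<lambda>i. lc_deriv b i y) (\<lambda>i. lc_deriv b i z)" for y z
    unfolding S_le_def
  proof (intro allI impI ballI)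
    fix i t assume it: "i < m" "t \<in> Iv b"
    then show "lc_deriv b i y t \<le> lc_deriv b i z t"
      using that by (intro D_lc_AE_le_imp_le[OF _ _ b _ it(2)] S_D_lc_deriv(1) b) (auto simp: ale_def)
  qed
  have S_le_fixed: "ale (\<lambda>i. lc_deriv b i (T x 0)) x \<and> ale x (\<lambda>i. lc_deriv b i (T x 0))"
    if "x \<in> X" "ale (T x) x" "ale x (T x)" for x
    using fixed_point[OF that] that(2,3) by (auto simp: ale_def)
  show ?least
  proof -
    obtain x where x: "x \<in> X" "ale (T x) x" "ale x (T x)" "\<And>z. z \<in> X \<Longrightarrow> ale (T z) z \<Longrightarrow> ale x z"
      using preorder_Knaster_Tarski_least[OF transp T_funcset mono hiX le_hi ale_inf] by blast
    note fp = fixed_point[OF x(1-3)]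
    have "S_le b m (T x 0) z" if z: "z \<in> S_interval b m ylo yhi" "supersolution b m g c z" for z
    proof (rule S_leI)
      have "ale (T (\<lambda>i. lc_deriv b i z)) (\<lambda>i. lc_deriv b i z)"
        unfolding ale_def using z super_T[of z "\<lambda>i. lc_deriv b i z"] interval_X[OF z(1)]
        by (auto simp: supersolution_def jet_eq_HK_tuple)
      then have "ale x (\<lambda>i. lc_deriv b i z)" using x(4) interval_X[OF z(1)] by blast
      then show "ale (\<lambda>i. lc_deriv b i (T x 0)) (\<lambda>i. lc_deriv b i z)"
        using S_le_fixed[OF x(1-3)] ale_trans by blast
    qed (use fp z in \<open>auto simp: S_interval_def\<close>)
    with fp show ?thesis by blast
  qed
  show ?greatest
  proof -
    obtain x where x: "x \<in> X" "ale (T x) x" "ale x (T x)" "\<And>z. z \<in> X \<Longrightarrow> ale z (T z) \<Longrightarrow> ale z x"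
      using preorder_Knaster_Tarski_greatest[OF transp T_funcset mono hiX le_hi loX lo_le ale_inf] by blast
    note fp = fixed_point[OF x(1-3)]
    have "S_le b m z (T x 0)" if z: "z \<in> S_interval b m ylo yhi" "subsolution b m g c z" for z
    proof (rule S_leI)
      have "ale (\<lambda>i. lc_deriv b i z) (T (\<lambda>i. lc_deriv b i z))"
        unfolding ale_def using z sub_T[of z "\<lambda>i. lc_deriv b i z"] interval_X[OF z(1)]
        by (auto simp: subsolution_def jet_eq_HK_tuple)
      then have "ale (\<lambda>i. lc_deriv b i z) x" using x(4) interval_X[OF z(1)] by blast
      then show "ale (\<lambda>i. lc_deriv b i z) (\<lambda>i. lc_deriv b i (T x 0))"
        using S_le_fixed[OF x(1-3)] ale_trans by blast
    qed (use fp z in \<open>auto simp: S_interval_def\<close>)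
    with fp show ?thesis by blast
  qed
qed

lemma solution_imp_sub_supersolution:
  "solution b m g c y \<Longrightarrow> subsolution b m g c y \<and> supersolution b m g c y"
  by (auto simp: solution_def subsolution_def supersolution_def A_le_def)

lemma solution_supersolution_of_smaller:
  assumes "solution b m g' c' y" "0 < b"
    "\<forall>x\<in>HK_loc_prod b m. A_le b (g x) (g' x)" "\<forall>i\<in>{1..m}. c i \<le> c' i"
  shows "supersolution b m g c y"
  using assms jet_in_HK_loc_prod[of y b m] by (auto simp: solution_def supersolution_def)

lemma solution_subsolution_of_larger:
  assumes "solution b m g c y" "0 < b"
    "\<forall>x\<in>HK_loc_prod b m. A_le b (g x) (g' x)" "\<forall>i\<in>{1..m}. c i \<le> c' i"
  shows "subsolution b m g' c' y"
  using assms jet_in_HK_loc_prod[of y b m] by (auto simp: solution_def subsolution_def)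

theorem theorem8p1:
  fixes b :: ereal and m :: nat and c :: "nat \<Rightarrow> real"
    and g :: "(nat \<Rightarrow> (real \<Rightarrow> real) set) \<Rightarrow> ((real \<Rightarrow> real) \<Rightarrow> real)"
    and ylo yhi :: "real \<Rightarrow> real"
  assumes b: "0 < b"
    and m: "1 \<le> m"
    and g: "increasing_rhs b m g"
    and sub: "subsolution b m g c ylo"
    and super: "supersolution b m g c yhi"
    and le: "S_le b m ylo yhi"
  shows "(\<exists>y. smallest_solution b m g c ylo yhi y) \<and>
         (\<exists>y. greatest_solution b m g c ylo yhi y) \<and>
         (\<forall>g' c'. increasing_rhs b m g' \<longrightarrow>
            subsolution b m g' c' ylo \<longrightarrow> supersolution b m g' c' yhi \<longrightarrow>
            (\<forall>x\<in>HK_loc_prod b m. A_le b (g x) (g' x)) \<longrightarrow> (\<forall>i\<in>{1..m}. c i \<le> c' i) \<longrightarrow>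
              (\<forall>y y'. smallest_solution b m g c ylo yhi y \<longrightarrow>
                 smallest_solution b m g' c' ylo yhi y' \<longrightarrow> S_le b m y y') \<and>
              (\<forall>y y'. greatest_solution b m g c ylo yhi y \<longrightarrow>
                 greatest_solution b m g' c' ylo yhi y' \<longrightarrow> S_le b m y y'))"
proof (intro conjI allI impI)
  obtain y0 where y0: "y0 \<in> S_interval b m ylo yhi" "solution b m g c y0"
    "\<And>z. z \<in> S_interval b m ylo yhi \<Longrightarrow> supersolution b m g c z \<Longrightarrow> S_le b m y0 z"
    using ex_extremal_solutions(1)[OF assms] by blast
  then show "\<exists>y. smallest_solution b m g c ylo yhi y"
    using solution_imp_sub_supersolution unfolding smallest_solution_def by blast
  show "\<exists>y. greatest_solution b m g c ylo yhi y"
    using ex_extremal_solutions(2)[OF assms] solution_imp_sub_supersolution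
    unfolding greatest_solution_def by blast
  fix g' c'
  assume g': "increasing_rhs b m g'" "subsolution b m g' c' ylo" "supersolution b m g' c' yhi"
    and le': "\<forall>x\<in>HK_loc_prod b m. A_le b (g x) (g' x)" "\<forall>i\<in>{1..m}. c i \<le> c' i"
  show "S_le b m y y'"
    if "smallest_solution b m g c ylo yhi y" "smallest_solution b m g' c' ylo yhi y'" for y y'
  proof (rule S_le_trans)
    show "S_le b m y y0" using that(1) y0(1,2) by (simp add: smallest_solution_def)
    show "S_le b m y0 y'"
      using that(2) solution_supersolution_of_smaller[OF _ b le'] y0(3) by (simp add: smallest_solution_def)
  qed
  obtain y1 where y1: "y1 \<in> S_interval b m ylo yhi" "solution b m g' c' y1"
    "\<And>z. z \<in> S_interval b m ylo yhi \<Longrightarrow> subsolution b m g' c' z \<Longrightarrow> S_le b m z y1"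
    using ex_extremal_solutions(2)[OF b m g' le] by blast
  show "S_le b m y y'"
    if "greatest_solution b m g c ylo yhi y" "greatest_solution b m g' c' ylo yhi y'" for y y'
  proof (rule S_le_trans)
    show "S_le b m y y1"
      using that(1) solution_subsolution_of_larger[OF _ b le'] y1(3) by (simp add: greatest_solution_def)
    show "S_le b m y1 y'" using that(2) y1(1,2) by (simp add: greatest_solution_def)
  qed
qed

end
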